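(* Let $X$ be a hyperelliptic curve of genus $g$ over a field $F$ of characteristic $\ne2$, with affine model $y^2=f(x)$, $\deg f=2g+1$. Whenever $\ell\le g$ and $\ell\equiv1\pmod4$ ($\ell\ge1$), the local Euler index in $\mathrm{GW}(F)$ of the complete linear series $|2\ell\infty_X|$, with basis $\lambda=(1,x,\dots,x^\ell)$, at $\infty_X$ is $$\mathrm{ind}_{\infty_X}w(\lambda)=\frac{\binom{\ell+1}2-1}2\cdot\mathbb{H}+\left\langle-\frac{(D^1h)(0)}2\right\rangle,$$ where $h(z)=z^{2g+2}f(z^{-1})$.
   Context: $X$ is smooth and projective, $\infty_X$ is the point over $x=\infty$. With $z=x^{-1}$ and $w=yx^{-(g+1)}$, $X$ is given near $\infty_X$ (which is $(z,w)=(0,0)$) by $w^2=h(z)$; $D^1h$ is the derivative of $h$. $\mathrm{GW}(F)$ is the Grothendieck--Witt group of nondegenerate symmetric bilinear forms, $\langle a\rangle$ the class of $(u,v)\mapsto auv$, $\mathbb{H}=\langle1\rangle+\langle-1\rangle$. Hasse derivatives with respect to the étale coordinate $w$ near $\infty_X$: $D^k_w$ are the unique $F$-linear maps on local functions with $D^0_w=\mathrm{id}$, $D^k_w(\phi\psi)=\sum_iD^i_w\phi\,D^{k-i}_w\psi$, $D^k_ww^n=\binom nkw^{n-k}$. Let $L=\mathcal{O}_X(2\ell\infty_X)$ and $r+1=h^0(L)=\ell+1$. The Hasse Wronskian $w(\lambda)$ is the section of $\det J^{r+1}(L)\cong L^{\otimes(r+1)}\otimes K_X^{\otimes\binom{r+1}2}$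 ($J^{r+1}(L)$ being the bundle of order-$r$ principal parts) represented, in terms of a local generator $s$ of $L$ and an étale coordinate $t$, by $\det(D^i_t(\lambda_j/s))$. Near $\infty_X$ one uses $s=x^\ell$, $t=w$, so that $\lambda$ becomes $(z^\ell,z^{\ell-1},\dots,z,1)$ and $w(\lambda)$ is represented by $\phi=\det(D^i_wz^{\ell-j})_{0\le i,j\le\ell}$. Since $\ell\equiv1\pmod4$, $r+1$ and $\binom{r+1}2+1$ are even, so $\mathcal{H}om(T_X,\det J^{r+1}(L))\cong L^{\otimes(r+1)}\otimes K_X^{\otimes(\binom{r+1}2+1)}$ is canonically a tensor square; this is the relative orientation, and the trivialization given by $s=x^\ell$ and $dw$ is compatible with it. Local Euler index: choose $n$ with $\mathfrak{m}_{\infty_X}^n\subset(\phi)$ and $G\in F[w]$ with $G-\phi\in\mathfrak{m}_{\infty_X}^{2n}$, and let $A=\mathcal{O}_{X,\infty_X}/(\phi)\cong F[w]_{(w)}/(G)$. Write the image of $\frac{G(w_1)-G(w_2)}{w_1-w_2}$ in $A\otimes_FA$ as $\sum a_i\otimes b_i$; there is a unique $F$-linear $\eta:A\to F$ with $\sum\eta(a_i)b_i=1$, and $\mathrm{ind}_{\infty_X}w(\lambda)$ is the class of $(a,b)\mapsto\eta(ab)$. *)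

theory Defs
  imports "Jordan_Normal_Form.Determinant" "HOL-Library.FuncSet"
begin

section \<open>The Grothendieck--Witt group\<close>

text \<open>A symmetric bilinear form on a finite-dimensional space is given by its Gram matrix in a
  basis; isometry is then congruence. The zero-dimensional form is the empty matrix.\<close>

definition nondeg_sym :: "'a::field mat \<Rightarrow> bool" where
  "nondeg_sym A \<longleftrightarrow> square_mat A \<and> transpose_mat A = A \<and> det A \<noteq> 0"

definition isometric :: "'a::field mat \<Rightarrow> 'a mat \<Rightarrow> bool" where
  "isometric A B \<longleftrightarrow> nondeg_sym A \<and> nondeg_sym B \<and> dim_row A = dim_row B \<and>
     (\<exists>P \<in> carrier_mat (dim_row A) (dim_row A). det P \<noteq> 0 \<and> B = transpose_mat P * A * P)"

definition orth_sum :: "'a::field mat \<Rightarrow> 'a mat \<Rightarrow> 'a mat" where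
  "orth_sum A B = four_block_mat A (0\<^sub>m (dim_row A) (dim_col B)) (0\<^sub>m (dim_row B) (dim_col A)) B"

lemma nondeg_symD:
  assumes "nondeg_sym A"
  shows "A \<in> carrier_mat (dim_row A) (dim_row A)" "transpose_mat A = A" "det A \<noteq> 0"
    "dim_col A = dim_row A"
  using assms by (auto simp: nondeg_sym_def)

lemma isometricI:
  assumes "nondeg_sym A" "P \<in> carrier_mat (dim_row A) (dim_row A)" "det P \<noteq> 0"
    and "B = transpose_mat P * A * P"
  shows "isometric A B"
proof -
  define n where "n = dim_row A"
  note A = nondeg_symD(1)[OF assms(1), folded n_def] and tA = nondeg_symD(2)[OF assms(1)]
    and dA = nondeg_symD(3)[OF assms(1)]
  note P = assms(2)[folded n_def]
  hence Pt: "transpose_mat P \<in> carrier_mat n n" by simp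
  have PA: "transpose_mat P * A \<in> carrier_mat n n" by (rule mult_carrier_mat[OF Pt A])
  have B: "B \<in> carrier_mat n n" unfolding assms(4) by (rule mult_carrier_mat[OF PA P])
  have "transpose_mat B = transpose_mat P * transpose_mat (transpose_mat P * A)"
    unfolding assms(4) by (rule transpose_mult[OF PA P])
  also have "transpose_mat (transpose_mat P * A) = A * P"
    unfolding transpose_mult[OF Pt A] tA by (simp only: transpose_transpose)
  also have "transpose_mat P * (A * P) = B"
    unfolding assms(4) by (rule assoc_mult_mat[OF Pt A P, symmetric])
  finally have tB: "transpose_mat B = B" .
  have "det B = det P * det A * det P"
    unfolding assms(4) det_mult[OF PA P] det_mult[OF Pt A] det_transpose[OF P] ..
  hence dB: "det B \<noteq> 0" using dA assms(3) by simp
  have "square_mat B" "dim_row A = dim_row B" using B n_def by (auto simp only: carrier_matD square_mat.simps)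
  thus ?thesis unfolding isometric_def nondeg_sym_def[of B]
    using assms(1,2,3,4) tB dB by blast
qed

lemma isometricE:
  assumes "isometric A B"
  obtains n P where "nondeg_sym A" "nondeg_sym B"
    "A \<in> carrier_mat n n" "B \<in> carrier_mat n n" "P \<in> carrier_mat n n"
    "det P \<noteq> 0" "B = transpose_mat P * A * P"
proof -
  from assms have A: "nondeg_sym A" and B: "nondeg_sym B" and d: "dim_row A = dim_row B"
    and "\<exists>P \<in> carrier_mat (dim_row A) (dim_row A). det P \<noteq> 0 \<and> B = transpose_mat P * A * P"
    unfolding isometric_def by blast+
  then obtain P where "P \<in> carrier_mat (dim_row A) (dim_row A)" "det P \<noteq> 0"
    "B = transpose_mat P * A * P" by blast
  from that[OF A B nondeg_symD(1)[OF A] nondeg_symD(1)[OF B, folded d] this] show ?thesis .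
qed

lemma isometric_refl:
  assumes "nondeg_sym A"
  shows "isometric A A"
proof (rule isometricI[OF assms one_carrier_mat])
  define n where "n = dim_row A"
  note A = nondeg_symD(1)[OF assms, folded n_def]
  show "A = transpose_mat (1\<^sub>m (dim_row A)) * A * 1\<^sub>m (dim_row A)"
    unfolding transpose_one n_def[symmetric] left_mult_one_mat[OF A] right_mult_one_mat[OF A] ..
qed simp

lemma isometric_sym:
  assumes "isometric A B"
  shows "isometric B A"
proof -
  from assms obtain n P where A: "nondeg_sym A" and B: "nondeg_sym B"
    and Ac: "A \<in> carrier_mat n n" and Bc: "B \<in> carrier_mat n n"
    and P: "P \<in> carrier_mat n n" and dP: "det P \<noteq> 0" and BP: "B = transpose_mat P * A * P"
    by (rule isometricE)
  from det_non_zero_imp_unit[OF P dP] obtain Q where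
    Q: "Q \<in> carrier_mat n n" and PQ: "P * Q = 1\<^sub>m n"
    unfolding Units_def by (auto simp: ring_mat_def)
  have Pt: "transpose_mat P \<in> carrier_mat n n" and Qt: "transpose_mat Q \<in> carrier_mat n n"
    using P Q by simp_all
  have PtA: "transpose_mat P * A \<in> carrier_mat n n" by (rule mult_carrier_mat[OF Pt Ac])
  have QtPt: "transpose_mat Q * transpose_mat P = 1\<^sub>m n"
    unfolding transpose_mult[OF P Q, symmetric] PQ by (rule transpose_one)
  have "transpose_mat Q * B * Q = transpose_mat Q * (transpose_mat P * A * P * Q)"
    unfolding BP using assoc_mult_mat[OF Qt mult_carrier_mat[OF PtA P] Q] .
  also have "transpose_mat P * A * P * Q = transpose_mat P * A"
    unfolding assoc_mult_mat[OF PtA P Q] PQ by (rule right_mult_one_mat[OF PtA])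
  also have "transpose_mat Q * (transpose_mat P * A) = A"
    unfolding assoc_mult_mat[OF Qt Pt Ac, symmetric] QtPt by (rule left_mult_one_mat[OF Ac])
  finally have AQ: "A = transpose_mat Q * B * Q" ..
  have "det P * det Q = 1"
    unfolding det_mult[OF P Q, symmetric] PQ by (rule det_one)
  hence dQ: "det Q \<noteq> 0" by auto
  show ?thesis
    by (rule isometricI[OF B _ dQ AQ]) (use Q Bc in simp)
qed

lemma isometric_trans:
  assumes "isometric A B" "isometric B C"
  shows "isometric A C"
proof -
  from assms(1) obtain n P where A: "nondeg_sym A" and Ac: "A \<in> carrier_mat n n"
    and Bc: "B \<in> carrier_mat n n" and P: "P \<in> carrier_mat n n" and dP: "det P \<noteq> 0"
    and BP: "B = transpose_mat P * A * P"
    by (rule isometricE)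
  from assms(2) obtain m Q where Bm: "B \<in> carrier_mat m m" and Qm: "Q \<in> carrier_mat m m"
    and dQ: "det Q \<noteq> 0" and CQ: "C = transpose_mat Q * B * Q"
    by (rule isometricE)
  have "m = n" using carrier_matD(1)[OF Bm] carrier_matD(1)[OF Bc] by simp
  with Qm have Q: "Q \<in> carrier_mat n n" by simp
  have Pt: "transpose_mat P \<in> carrier_mat n n" and Qt: "transpose_mat Q \<in> carrier_mat n n"
    using P Q by simp_all
  have PtA: "transpose_mat P * A \<in> carrier_mat n n" by (rule mult_carrier_mat[OF Pt Ac])
  have PtAP: "transpose_mat P * A * P \<in> carrier_mat n n" by (rule mult_carrier_mat[OF PtA P])
  have PQ: "P * Q \<in> carrier_mat n n" by (rule mult_carrier_mat[OF P Q])
  have C: "C = transpose_mat (P * Q) * A * (P * Q)"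
    unfolding CQ BP transpose_mult[OF P Q] assoc_mult_mat[OF Qt Pt Ac]
      assoc_mult_mat[OF Qt PtA PQ] assoc_mult_mat[OF PtA P Q, symmetric]
    by (rule assoc_mult_mat[OF Qt PtAP Q])
  have dPQ: "det (P * Q) \<noteq> 0" unfolding det_mult[OF P Q] using dP dQ by simp
  show ?thesis
    by (rule isometricI[OF A _ dPQ C]) (use PQ Ac in simp)
qed

lemma orth_sum_carrier:
  assumes "A \<in> carrier_mat n n" "B \<in> carrier_mat m m"
  shows "orth_sum A B \<in> carrier_mat (n + m) (n + m)"
    and "orth_sum A B = four_block_mat A (0\<^sub>m n m) (0\<^sub>m m n) B"
  using assms unfolding orth_sum_def by simp_all

lemma orth_sum_nondeg:
  assumes "nondeg_sym A" "nondeg_sym B"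
  shows "nondeg_sym (orth_sum A B)"
proof -
  define n where "n = dim_row A"
  define m where "m = dim_row B"
  note A = nondeg_symD(1)[OF assms(1), folded n_def] and B = nondeg_symD(1)[OF assms(2), folded m_def]
  note S = orth_sum_carrier[OF A B]
  have "det (orth_sum A B) = det A * det B"
    unfolding S(2) by (rule det_four_block_mat_lower_left_zero[OF A _ _ B]) simp_all
  hence d: "det (orth_sum A B) \<noteq> 0"
    using nondeg_symD(3)[OF assms(1)] nondeg_symD(3)[OF assms(2)] by simp
  have t: "transpose_mat (orth_sum A B) = orth_sum A B"
    unfolding S(2) transpose_four_block_mat[OF A zero_carrier_mat zero_carrier_mat B]
      nondeg_symD(2)[OF assms(1)] nondeg_symD(2)[OF assms(2)] zero_transpose_mat ..
  have "square_mat (orth_sum A B)" using S(1) by simp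
  with d t show ?thesis unfolding nondeg_sym_def by blast
qed

lemma diag_mult_diag:
  assumes "A \<in> carrier_mat n n" "B \<in> carrier_mat m m" "C \<in> carrier_mat n n" "D \<in> carrier_mat m m"
  shows "four_block_mat A (0\<^sub>m n m) (0\<^sub>m m n) B * four_block_mat C (0\<^sub>m n m) (0\<^sub>m m n) D =
    four_block_mat (A * C) (0\<^sub>m n m) (0\<^sub>m m n) (B * D)"
  unfolding mult_four_block_mat[OF assms(1) zero_carrier_mat zero_carrier_mat assms(2)
      assms(3) zero_carrier_mat zero_carrier_mat assms(4)]
  using assms mult_carrier_mat[OF assms(1,3)] mult_carrier_mat[OF assms(2,4)] by simp

lemma orth_sum_isometric:
  assumes "isometric A A'" "isometric B B'"
  shows "isometric (orth_sum A B) (orth_sum A' B')"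
proof -
  from assms(1) obtain n P where A: "nondeg_sym A" and Ac: "A \<in> carrier_mat n n"
    and A': "A' \<in> carrier_mat n n" and P: "P \<in> carrier_mat n n" and dP: "det P \<noteq> 0"
    and AP: "A' = transpose_mat P * A * P"
    by (rule isometricE)
  from assms(2) obtain m Q where B: "nondeg_sym B" and Bc: "B \<in> carrier_mat m m"
    and B': "B' \<in> carrier_mat m m" and Q: "Q \<in> carrier_mat m m" and dQ: "det Q \<noteq> 0"
    and BQ: "B' = transpose_mat Q * B * Q"
    by (rule isometricE)
  let ?R = "four_block_mat P (0\<^sub>m n m) (0\<^sub>m m n) Q"
  have R: "?R \<in> carrier_mat (n + m) (n + m)" by (rule four_block_carrier_mat[OF P Q])
  have "det ?R = det P * det Q"
    by (rule det_four_block_mat_lower_left_zero[OF P _ _ Q]) simp_all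
  hence dR: "det ?R \<noteq> 0" using dP dQ by simp
  have Pt: "transpose_mat P \<in> carrier_mat n n" and Qt: "transpose_mat Q \<in> carrier_mat m m"
    using P Q by simp_all
  have tR: "transpose_mat ?R = four_block_mat (transpose_mat P) (0\<^sub>m n m) (0\<^sub>m m n) (transpose_mat Q)"
    unfolding transpose_four_block_mat[OF P zero_carrier_mat zero_carrier_mat Q]
      zero_transpose_mat ..
  have eq: "orth_sum A' B' = transpose_mat ?R * orth_sum A B * ?R"
    unfolding tR orth_sum_carrier(2)[OF Ac Bc] orth_sum_carrier(2)[OF A' B']
      diag_mult_diag[OF Pt Qt Ac Bc]
      diag_mult_diag[OF mult_carrier_mat[OF Pt Ac] mult_carrier_mat[OF Qt Bc] P Q]
    unfolding AP BQ ..
  show ?thesis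
    by (rule isometricI[OF orth_sum_nondeg[OF A B] _ dR eq])
      (use R orth_sum_carrier(1)[OF Ac Bc] in simp)
qed

lemma orth_sum_assoc: "orth_sum (orth_sum A B) C = orth_sum A (orth_sum B C)"
  unfolding orth_sum_def by (rule assoc_four_block_mat[symmetric])

lemma orth_sum_commute:
  fixes A B :: "'a::field mat"
  assumes "nondeg_sym A" "nondeg_sym B"
  shows "isometric (orth_sum A B) (orth_sum B A)"
proof -
  define n where "n = dim_row A"
  define m where "m = dim_row B"
  note A = nondeg_symD(1)[OF assms(1), folded n_def] and B = nondeg_symD(1)[OF assms(2), folded m_def]
  let ?R = "four_block_mat (0\<^sub>m n m :: 'a mat) (1\<^sub>m n) (1\<^sub>m m) (0\<^sub>m m n)"
  let ?S = "four_block_mat (0\<^sub>m m n :: 'a mat) (1\<^sub>m m) (1\<^sub>m n) (0\<^sub>m n m)"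
  have R: "?R \<in> carrier_mat (n + m) (n + m)" by (rule carrier_matI) simp_all
  have S: "?S \<in> carrier_mat (n + m) (n + m)" by (rule carrier_matI) simp_all
  have tR: "transpose_mat ?R = ?S"
    unfolding transpose_four_block_mat[OF zero_carrier_mat one_carrier_mat one_carrier_mat
        zero_carrier_mat] zero_transpose_mat transpose_one ..
  have "?R * ?S = 1\<^sub>m (n + m)"
    unfolding mult_four_block_mat[OF zero_carrier_mat one_carrier_mat one_carrier_mat
        zero_carrier_mat zero_carrier_mat one_carrier_mat one_carrier_mat zero_carrier_mat]
    by simp
  hence "det ?R * det ?S = 1"
    unfolding det_mult[OF R S, symmetric] by simp
  hence dR: "det ?R \<noteq> 0" by auto
  have SA: "?S * orth_sum A B = four_block_mat (0\<^sub>m m n) B A (0\<^sub>m n m)"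
    unfolding orth_sum_carrier(2)[OF A B] mult_four_block_mat[OF zero_carrier_mat one_carrier_mat
        one_carrier_mat zero_carrier_mat A zero_carrier_mat zero_carrier_mat B]
    using A B by simp
  have eq: "orth_sum B A = transpose_mat ?R * orth_sum A B * ?R"
    unfolding tR SA orth_sum_carrier(2)[OF B A] mult_four_block_mat[OF zero_carrier_mat B A
        zero_carrier_mat zero_carrier_mat one_carrier_mat one_carrier_mat zero_carrier_mat]
    using A B by simp
  show ?thesis
    by (rule isometricI[OF orth_sum_nondeg[OF assms] _ dR eq])
      (use R orth_sum_carrier(1)[OF A B] in simp)
qed

lemma nondeg_sym_empty: "nondeg_sym (1\<^sub>m 0)"
  by (auto simp: nondeg_sym_def)

lemma orth_sum_empty: "orth_sum (1\<^sub>m 0) A = A"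
  unfolding orth_sum_def by (rule eq_matI) auto

quotient_type (overloaded) 'a form_class = "'a::field mat" / partial: isometric
proof (rule part_equivpI)
  show "\<exists>A :: 'a mat. isometric A A" using isometric_refl nondeg_sym_empty by blast
  show "symp (isometric :: 'a mat \<Rightarrow> _)" by (rule sympI) (rule isometric_sym)
  show "transp (isometric :: 'a mat \<Rightarrow> _)" by (rule transpI) (rule isometric_trans)
qed

instantiation form_class :: (field) comm_monoid_add
begin

lift_definition zero_form_class :: "'a form_class" is "1\<^sub>m 0"
  by (rule isometric_refl[OF nondeg_sym_empty])

lift_definition plus_form_class :: "'a form_class \<Rightarrow> 'a form_class \<Rightarrow> 'a form_class" is orth_sum
  by (rule orth_sum_isometric)

instance
proof
  fix a b c :: "'a form_class"
  show "a + b + c = a + (b + c)"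
    by transfer (metis orth_sum_assoc isometric_refl isometric_def orth_sum_nondeg)
  show "a + b = b + a"
    by transfer (metis orth_sum_commute isometric_def)
  show "0 + a = a"
    by transfer (simp add: orth_sum_empty)
qed

end

text \<open>Group completion: the pair \<open>(q, q')\<close> stands for \<open>q - q'\<close>.\<close>

definition gw_rel :: "'a::field form_class \<times> 'a form_class \<Rightarrow> 'a form_class \<times> 'a form_class \<Rightarrow> bool"
  where "gw_rel p q \<longleftrightarrow> (\<exists>e. fst p + snd q + e = fst q + snd p + e)"

quotient_type (overloaded) 'a gw = "'a::field form_class \<times> 'a form_class" / gw_rel
proof (rule equivpI)
  show "reflp (gw_rel :: 'a form_class \<times> _ \<Rightarrow> _)" by (rule reflpI) (simp add: gw_rel_def)
  show "symp (gw_rel :: 'a form_class \<times> _ \<Rightarrow> _)" by (rule sympI) (auto simp: gw_rel_def intro: sym)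
  show "transp (gw_rel :: 'a form_class \<times> _ \<Rightarrow> _)"
  proof (rule transpI)
    fix p q r :: "'a form_class \<times> 'a form_class"
    assume "gw_rel p q" "gw_rel q r"
    then obtain e e' where e: "fst p + snd q + e = fst q + snd p + e"
      and e': "fst q + snd r + e' = fst r + snd q + e'"
      unfolding gw_rel_def by auto
    have "fst p + snd r + (snd q + e + e' + fst q) = (fst p + snd q + e) + (fst q + snd r + e')"
      by (simp add: ac_simps)
    also have "\<dots> = fst r + snd p + (snd q + e + e' + fst q)"
      unfolding e e' by (simp add: ac_simps)
    finally show "gw_rel p r" unfolding gw_rel_def by blast
  qed
qed

instantiation gw :: (field) ab_group_add
begin

lift_definition zero_gw :: "'a gw" is "(0, 0)" .

lift_definition plus_gw :: "'a gw \<Rightarrow> 'a gw \<Rightarrow> 'a gw" is "\<lambda>p q. (fst p + fst q, snd p + snd q)"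
proof -
  fix p p' q q' :: "'a form_class \<times> 'a form_class"
  assume "gw_rel p p'" "gw_rel q q'"
  then obtain e e' where e: "fst p + snd p' + e = fst p' + snd p + e"
    and e': "fst q + snd q' + e' = fst q' + snd q + e'"
    unfolding gw_rel_def by auto
  have "fst p + fst q + (snd p' + snd q') + (e + e')
      = (fst p + snd p' + e) + (fst q + snd q' + e')"
    by (simp add: ac_simps)
  also have "\<dots> = fst p' + fst q' + (snd p + snd q) + (e + e')"
    unfolding e e' by (simp add: ac_simps)
  finally show "gw_rel (fst p + fst q, snd p + snd q) (fst p' + fst q', snd p' + snd q')"
    unfolding gw_rel_def by auto
qed

lift_definition uminus_gw :: "'a gw \<Rightarrow> 'a gw" is "\<lambda>p. (snd p, fst p)"
  unfolding gw_rel_def by (metis add.commute fst_conv snd_conv)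

definition minus_gw :: "'a gw \<Rightarrow> 'a gw \<Rightarrow> 'a gw" where "minus_gw a b = a + - b"

instance
proof
  fix a b c :: "'a gw"
  show "a + b + c = a + (b + c)" by transfer (simp add: gw_rel_def ac_simps)
  show "a + b = b + a" by transfer (simp add: gw_rel_def ac_simps)
  show "0 + a = a" by transfer (simp add: gw_rel_def)
  show "- a + a = 0" by transfer (simp add: gw_rel_def ac_simps)
  show "a - b = a + - b" by (rule minus_gw_def)
qed

end

text \<open>Only meaningful for \<open>nondeg_sym A\<close>; the same applies to \<open>gw_unit a\<close> and \<open>a \<noteq> 0\<close>.\<close>

definition gw_form :: "'a::field mat \<Rightarrow> 'a gw" where
  "gw_form A = abs_gw (abs_form_class A, 0)"

definition gw_unit :: "'a::field \<Rightarrow> 'a gw" where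
  "gw_unit a = gw_form (mat 1 1 (\<lambda>_. a))"

definition gw_hyperbolic :: "'a::field gw" where
  "gw_hyperbolic = gw_unit 1 + gw_unit (- 1)"


section \<open>Local rings of functions inside a field\<close>

text \<open>Throughout, \<open>\<iota> :: 'a \<Rightarrow> 'k\<close> is an embedding of the ground field into a field of functions,
  and a local ring is a subset \<open>R\<close> of the latter.\<close>

definition eval1 :: "('a::field \<Rightarrow> 'k::field) \<Rightarrow> 'a poly \<Rightarrow> 'k \<Rightarrow> 'k" where
  "eval1 \<iota> p u = poly (map_poly \<iota> p) u"

text \<open>An element of \<open>'a poly poly\<close> is a polynomial in two variables: the inner variable is
  evaluated at \<open>u\<close>, the outer one at \<open>v\<close>.\<close>

definition eval2 :: "('a::field \<Rightarrow> 'k::field) \<Rightarrow> 'a poly poly \<Rightarrow> 'k \<Rightarrow> 'k \<Rightarrow> 'k" where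
  "eval2 \<iota> P u v = poly (map_poly (\<lambda>p. eval1 \<iota> p u) P) v"

definition principal :: "'k::field set \<Rightarrow> 'k \<Rightarrow> 'k set" where
  "principal R a = (\<lambda>b. a * b) ` R"

primrec ideal_pow :: "'k::field set \<Rightarrow> 'k set \<Rightarrow> nat \<Rightarrow> 'k set" where
  "ideal_pow R m 0 = R"
| "ideal_pow R m (Suc n) =
     {\<Sum>i<k. a i * b i | (k::nat) a b. \<forall>i<k. a i \<in> m \<and> b i \<in> ideal_pow R m n}"


section \<open>Hasse derivatives and the Hasse Wronskian\<close>

text \<open>\<open>D k\<close> is a map \<open>R \<rightarrow> R\<close>; the extensional function space makes it a unique object of
  type \<open>'k \<Rightarrow> 'k\<close>.\<close>

definition hasse_system ::
    "('a::field \<Rightarrow> 'k::field) \<Rightarrow> 'k set \<Rightarrow> 'k \<Rightarrow> (nat \<Rightarrow> 'k \<Rightarrow> 'k) \<Rightarrow> bool" where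
  "hasse_system \<iota> R t D \<longleftrightarrow>
     (\<forall>k. D k \<in> R \<rightarrow>\<^sub>E R) \<and>
     (\<forall>k. \<forall>a\<in>R. \<forall>b\<in>R. D k (a + b) = D k a + D k b) \<and>
     (\<forall>k c. \<forall>a\<in>R. D k (\<iota> c * a) = \<iota> c * D k a) \<and>
     (\<forall>a\<in>R. D 0 a = a) \<and>
     (\<forall>k. \<forall>a\<in>R. \<forall>b\<in>R. D k (a * b) = (\<Sum>i\<le>k. D i a * D (k - i) b)) \<and>
     (\<forall>k n. D k (t ^ n) = of_nat (n choose k) * t ^ (n - k))"

definition hasse_deriv ::
    "('a::field \<Rightarrow> 'k::field) \<Rightarrow> 'k set \<Rightarrow> 'k \<Rightarrow> nat \<Rightarrow> 'k \<Rightarrow> 'k" where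
  "hasse_deriv \<iota> R t = (THE D. hasse_system \<iota> R t D)"

text \<open>The Hasse Wronskian of the sections \<open>ls\<close> in the trivialization given by the local
  generator \<open>s\<close> and the coordinate \<open>t\<close>.\<close>

definition hasse_wronskian ::
    "('a::field \<Rightarrow> 'k::field) \<Rightarrow> 'k set \<Rightarrow> 'k \<Rightarrow> 'k \<Rightarrow> 'k list \<Rightarrow> 'k" where
  "hasse_wronskian \<iota> R t s ls =
     det (mat (length ls) (length ls) (\<lambda>(i, j). hasse_deriv \<iota> R t i (ls ! j / s)))"


section \<open>The local Euler index\<close>

text \<open>\<open>(G(w\<^sub>1) - G(w\<^sub>2)) / (w\<^sub>1 - w\<^sub>2)\<close>, with \<open>w\<^sub>1\<close> the inner and \<open>w\<^sub>2\<close> the outer variable. The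
  division is exact.\<close>

definition difference_quotient :: "'a::field poly \<Rightarrow> 'a poly poly" where
  "difference_quotient G = ([:G:] - map_poly (\<lambda>c. [:c:]) G) div [:[:0, 1:], - 1:]"

text \<open>The algebra \<open>A = R/(\<phi>)\<close> is handled through representatives: a linear functional on \<open>A\<close> is a
  linear functional on \<open>R\<close> vanishing on \<open>(\<phi>)\<close>, and equality in \<open>A\<close> is congruence modulo \<open>(\<phi>)\<close>.
  If \<open>\<Sum>\<^sub>j B\<^sub>j(w\<^sub>1) w\<^sub>2\<^sup>j\<close> is the difference quotient of \<open>G\<close>, then its image in \<open>A \<otimes> A\<close> is
  \<open>\<Sum>\<^sub>j a\<^sub>j \<otimes> b\<^sub>j\<close> with \<open>a\<^sub>j = B\<^sub>j(t)\<close> and \<open>b\<^sub>j = t\<^sup>j\<close>.\<close>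

definition dual_functional ::
    "('a::field \<Rightarrow> 'k::field) \<Rightarrow> 'k set \<Rightarrow> 'k \<Rightarrow> 'k \<Rightarrow> 'a poly \<Rightarrow> ('k \<Rightarrow> 'a) \<Rightarrow> bool" where
  "dual_functional \<iota> R t \<phi> G \<eta> \<longleftrightarrow>
     (\<forall>a\<in>R. \<forall>b\<in>R. \<eta> (a + b) = \<eta> a + \<eta> b) \<and>
     (\<forall>c. \<forall>a\<in>R. \<eta> (\<iota> c * a) = c * \<eta> a) \<and>
     (\<forall>a\<in>principal R \<phi>. \<eta> a = 0) \<and>
     (let B = difference_quotient G in
       (\<Sum>j\<le>degree B. \<iota> (\<eta> (eval1 \<iota> (coeff B j) t)) * t ^ j) - 1 \<in> principal R \<phi>)"

definition quotient_basis ::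
    "('a::field \<Rightarrow> 'k::field) \<Rightarrow> 'k set \<Rightarrow> 'k \<Rightarrow> 'k list \<Rightarrow> bool" where
  "quotient_basis \<iota> R \<phi> es \<longleftrightarrow> set es \<subseteq> R \<and>
     (\<forall>a\<in>R. \<exists>!cs. length cs = length es \<and>
        a - (\<Sum>i<length es. \<iota> (cs ! i) * es ! i) \<in> principal R \<phi>)"

text \<open>The class of \<open>(a, b) \<mapsto> \<eta>(ab)\<close> on \<open>R/(\<phi>)\<close>, which does not depend on the choices of
  \<open>n\<close>, \<open>G\<close> and of the basis \<open>es\<close> used to write down the Gram matrix.\<close>

definition euler_index ::
    "('a::field \<Rightarrow> 'k::field) \<Rightarrow> 'k set \<Rightarrow> 'k set \<Rightarrow> 'k \<Rightarrow> 'k \<Rightarrow> 'a gw" where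
  "euler_index \<iota> R m t \<phi> = (THE c. \<exists>n G \<eta> es.
     ideal_pow R m n \<subseteq> principal R \<phi> \<and>
     eval1 \<iota> G t - \<phi> \<in> ideal_pow R m (2 * n) \<and>
     dual_functional \<iota> R t \<phi> G \<eta> \<and>
     quotient_basis \<iota> R \<phi> es \<and>
     c = gw_form (mat (length es) (length es) (\<lambda>(i, j). \<eta> (es ! i * es ! j))))"


section \<open>The hyperelliptic curve at infinity\<close>

text \<open>The curve is given by its function field \<open>F(x, y)\<close>, a subfield of \<open>'k\<close>: \<open>x\<close> is
  transcendental over \<open>F\<close> and \<open>y\<^sup>2 = f(x)\<close>. As \<open>f\<close> has odd degree it is not a square in \<open>F(x)\<close>, so this
  determines \<open>F(x, y)\<close> up to isomorphism. Coprimality of \<open>f\<close> and its derivative is smoothness of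
  the affine model in characteristic other than 2.\<close>

definition hyperelliptic_curve ::
    "('a::field \<Rightarrow> 'k::field) \<Rightarrow> 'k \<Rightarrow> 'k \<Rightarrow> 'a poly \<Rightarrow> nat \<Rightarrow> bool" where
  "hyperelliptic_curve \<iota> x y f g \<longleftrightarrow>
     field_hom \<iota> \<and>
     (\<forall>p. p \<noteq> 0 \<longrightarrow> eval1 \<iota> p x \<noteq> 0) \<and>
     y ^ 2 = eval1 \<iota> f x \<and>
     degree f = 2 * g + 1 \<and>
     coprime f (pderiv f)"

text \<open>\<open>h(z) = z\<^sup>2\<^sup>g\<^sup>+\<^sup>2 f(1/z)\<close>\<close>

definition h_poly :: "nat \<Rightarrow> 'a::field poly \<Rightarrow> 'a poly" where
  "h_poly g f = (\<Sum>i\<le>2 * g + 2. monom (coeff f i) (2 * g + 2 - i))"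

definition z_coord :: "'k::field \<Rightarrow> 'k" where
  "z_coord x = inverse x"

definition w_coord :: "'k::field \<Rightarrow> 'k \<Rightarrow> nat \<Rightarrow> 'k" where
  "w_coord x y g = y / x ^ (g + 1)"

text \<open>The local ring of the chart \<open>w\<^sup>2 = h(z)\<close> at \<open>(z, w) = (0, 0)\<close>, and its maximal ideal.\<close>

definition local_ring_inf :: "('a::field \<Rightarrow> 'k::field) \<Rightarrow> 'k \<Rightarrow> 'k \<Rightarrow> nat \<Rightarrow> 'k set" where
  "local_ring_inf \<iota> x y g =
     {eval2 \<iota> P (z_coord x) (w_coord x y g) / eval2 \<iota> Q (z_coord x) (w_coord x y g) | P Q.
        poly (poly Q 0) 0 \<noteq> 0}"

definition max_ideal_inf :: "('a::field \<Rightarrow> 'k::field) \<Rightarrow> 'k \<Rightarrow> 'k \<Rightarrow> nat \<Rightarrow> 'k set" where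
  "max_ideal_inf \<iota> x y g =
     {eval2 \<iota> P (z_coord x) (w_coord x y g) / eval2 \<iota> Q (z_coord x) (w_coord x y g) | P Q.
        poly (poly P 0) 0 = 0 \<and> poly (poly Q 0) 0 \<noteq> 0}"

text \<open>The index at infinity of the Wronskian of the linear series with basis \<open>ls\<close>, for a line
  bundle generated near infinity by \<open>s\<close>, using the coordinate \<open>w\<close>. The relative orientation enters
  only through this trivialization, which has to be compatible with it.\<close>

definition wronskian_index_inf ::
    "('a::field \<Rightarrow> 'k::field) \<Rightarrow> 'k \<Rightarrow> 'k \<Rightarrow> nat \<Rightarrow> 'k \<Rightarrow> 'k list \<Rightarrow> 'a gw" where
  "wronskian_index_inf \<iota> x y g s ls =
     (let R = local_ring_inf \<iota> x y g; w = w_coord x y g in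
       euler_index \<iota> R (max_ideal_inf \<iota> x y g) w (hasse_wronskian \<iota> R w s ls))"

end

theory Submission
  imports Defs "HOL-Computational_Algebra.Polynomial_FPS"
begin

text \<open>The local ring at infinity has coefficient field \<open>F\<close> and uniformizer \<open>w\<close>, so Taylor expansion in
  \<open>w\<close> embeds it into \<open>F[[t]]\<close>; this intertwines the Hasse derivatives. Writing \<open>a = (D\<^sup>1h)(0)\<close>, the
  equation \<open>w\<^sup>2 = h(z)\<close> gives \<open>z = t\<^sup>2/a + \<dots>\<close>. Hence the Wronskian of \<open>z\<^sup>l, \<dots>, z, 1\<close> has leading term
  \<open>det (binom (2(l - j)) i) a\<^sup>-\<^sup>N t\<^sup>N = (-2/a)\<^sup>N t\<^sup>N\<close> with \<open>N = binom (l + 1) 2\<close>, which is odd because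
  \<open>l \<equiv> 1 (mod 4)\<close>.

  For a function \<open>\<phi> = t\<^sup>N E(t)\<close> with \<open>E(0) \<noteq> 0\<close>, the functional \<open>\<eta>\<close> is the residue
  \<open>r \<mapsto> Res (r/\<phi> dt)\<close>. After division by a square root of \<open>E(0)/E\<close> its Gram matrix becomes anti-diagonal
  with entries \<open>1/E(0)\<close>, so for odd \<open>N\<close> the form is \<open>(N - 1)/2\<close> hyperbolic planes plus \<open>\<langle>1/E(0)\<rangle>\<close>; and
  \<open>(-a/2)\<^sup>N\<close> differs from \<open>-a/2\<close> by a square.\<close>

section \<open>Hasse derivatives of power series and binomial determinants\<close>

text \<open>The local ring is not complete: a power series need not be the expansion of a function,
  so the Hasse derivative of an expansion has to be shown to come from the ring again. Elements of
  the ring are quotients of polynomials in \<open>z\<close> and \<open>w\<close>, and the real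
  question is \<open>z\<close>, settled by solving \<open>h(z) = w^2\<close> with
  \<open>h'(0)\<close> nonzero. Both the derivatives and the index are given by definite
  descriptions, so uniqueness carries as much weight as existence: the index must be the same for
  every admissible exponent, polynomial, functional and basis. The characteristic may be positive,
  so Hasse derivatives cannot be obtained by dividing by factorials. That the binomial determinant
  is a power of 2 up to sign is what makes the leading coefficient nonzero in every characteristic
  other than 2.\<close>

definition fps_hasse :: "nat \<Rightarrow> 'a::comm_ring_1 fps \<Rightarrow> 'a fps" where
  "fps_hasse k s = Abs_fps (\<lambda>n. of_nat ((n + k) choose k) * fps_nth s (n + k))"

lemma fps_hasse_nth [simp]:
  "fps_nth (fps_hasse k s) n = of_nat ((n + k) choose k) * fps_nth s (n + k)"
  by (simp add: fps_hasse_def)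

lemma fps_hasse_add: "fps_hasse k (s + t) = fps_hasse k s + fps_hasse k t"
  by (rule fps_ext) (simp add: algebra_simps)

lemma fps_hasse_0 [simp]: "fps_hasse 0 s = s"
  by (rule fps_ext) simp

lemma fps_hasse_const_mult: "fps_hasse k (fps_const c * s) = fps_const c * fps_hasse k s"
  by (rule fps_ext) (simp add: algebra_simps)

lemma fps_hasse_X_power: "fps_hasse k (fps_X ^ n) = of_nat (n choose k) * fps_X ^ (n - k)"
proof (rule fps_ext)
  fix m
  have "of_nat (n choose k) = fps_const (of_nat (n choose k) :: 'a)" by (simp add: fps_of_nat)
  then show "fps_nth (fps_hasse k (fps_X ^ n)) m = fps_nth (of_nat (n choose k) * fps_X ^ (n - k) :: 'a fps) m"
    by (cases "k \<le> n") (auto simp: fps_X_power_nth binomial_eq_0)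
qed

text \<open>Multiplication by \<open>X^k\<close> makes the operator diagonal on coefficients, which
  removes the index shift from the Leibniz rule and from the rows of the Wronskian.\<close>

lemma fps_X_power_mult_hasse:
  "fps_nth (fps_X ^ k * fps_hasse k s) n = of_nat (n choose k) * fps_nth s n"
  by (auto simp: fps_X_power_mult_nth binomial_eq_0)

text \<open>After multiplication by \<open>X^k\<close>, the claim in each degree is the Vandermonde
  convolution of binomials. The factor \<open>X^k\<close> is removed by reading coefficient
  \<open>n + k\<close>.\<close>

lemma fps_hasse_mult:
  "fps_hasse k (s * t) = (\<Sum>i\<le>k. fps_hasse i s * fps_hasse (k - i) t)"
proof -
  have eq: "fps_X ^ k * fps_hasse k (s * t) =
      (\<Sum>i\<le>k. (fps_X ^ i * fps_hasse i s) * (fps_X ^ (k - i) * fps_hasse (k - i) t))"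
  proof (rule fps_ext)
    fix n
    have "fps_nth (\<Sum>i\<le>k. (fps_X ^ i * fps_hasse i s) * (fps_X ^ (k - i) * fps_hasse (k - i) t)) n
      = (\<Sum>i\<le>k. \<Sum>p=0..n. of_nat (p choose i) * fps_nth s p *
            (of_nat ((n - p) choose (k - i)) * fps_nth t (n - p)))"
      by (simp only: fps_sum_nth fps_mult_nth[of "_ * _" "_ * _"] fps_X_power_mult_hasse)
    also have "\<dots> = (\<Sum>p=0..n. \<Sum>i\<le>k. of_nat ((p choose i) * ((n - p) choose (k - i))) *
            (fps_nth s p * fps_nth t (n - p)))"
      by (subst sum.swap) (simp add: algebra_simps)
    also have "\<dots> = (\<Sum>p=0..n. of_nat (\<Sum>i\<le>k. (p choose i) * ((n - p) choose (k - i))) *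
            (fps_nth s p * fps_nth t (n - p)))"
      by (simp only: of_nat_sum sum_distrib_right)
    also have "\<dots> = (\<Sum>p=0..n. of_nat (n choose k) * (fps_nth s p * fps_nth t (n - p)))"
    proof (intro sum.cong refl)
      fix p assume "p \<in> {0..n}"
      hence "(\<Sum>i\<le>k. (p choose i) * ((n - p) choose (k - i))) = n choose k"
        using vandermonde[of p "n - p" k] by simp
      thus "of_nat (\<Sum>i\<le>k. (p choose i) * ((n - p) choose (k - i))) * (fps_nth s p * fps_nth t (n - p))
        = of_nat (n choose k) * (fps_nth s p * fps_nth t (n - p))" by simp
    qed
    also have "\<dots> = fps_nth (fps_X ^ k * fps_hasse k (s * t)) n"
      by (simp only: fps_X_power_mult_hasse fps_mult_nth[of s t] sum_distrib_left)
    finally show "fps_nth (fps_X ^ k * fps_hasse k (s * t)) n = fps_nth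
      (\<Sum>i\<le>k. (fps_X ^ i * fps_hasse i s) * (fps_X ^ (k - i) * fps_hasse (k - i) t)) n" ..
  qed
  also have "\<dots> = fps_X ^ k * (\<Sum>i\<le>k. fps_hasse i s * fps_hasse (k - i) t)"
  proof -
    have "(fps_X ^ i * fps_hasse i s) * (fps_X ^ (k - i) * fps_hasse (k - i) t)
        = fps_X ^ k * (fps_hasse i s * fps_hasse (k - i) t)" if "i \<le> k" for i
    proof -
      have "fps_X ^ k = fps_X ^ i * (fps_X ^ (k - i) :: 'a fps)"
        using that by (simp flip: power_add)
      thus ?thesis by (simp only: mult_ac)
    qed
    thus ?thesis by (simp add: sum_distrib_left)
  qed
  finally have eq: "fps_X ^ k * fps_hasse k (s * t) =
    fps_X ^ k * (\<Sum>i\<le>k. fps_hasse i s * fps_hasse (k - i) t)" .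
  show ?thesis
  proof (rule fps_ext)
    fix n
    show "fps_nth (fps_hasse k (s * t)) n = fps_nth (\<Sum>i\<le>k. fps_hasse i s * fps_hasse (k - i) t) n"
      using arg_cong[OF eq, of "\<lambda>u. fps_nth u (n + k)"] by (simp only: fps_X_power_mult_nth) simp
  qed
qed

section \<open>Determinants of reversed, scaled and binomial matrices\<close>

lemma det_reversal:
  "det (mat n n (\<lambda>(i, j). if i + j + 1 = n then 1 else 0 :: 'a::comm_ring_1)) = (- 1) ^ (n choose 2)"
proof (induction n)
  case 0
  then show ?case by (simp add: numeral_2_eq_2)
next
  case (Suc n)
  let ?J = "\<lambda>n. mat n n (\<lambda>(i, j). if i + j + 1 = n then 1 else 0 :: 'a)"
  have "det (?J (Suc n)) = (\<Sum>j<Suc n. ?J (Suc n) $$ (0, j) * cofactor (?J (Suc n)) 0 j)"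
    by (rule laplace_expansion_row) auto
  also have "\<dots> = (\<Sum>j<Suc n. if j = n then cofactor (?J (Suc n)) 0 j else 0)"
    by (intro sum.cong) auto
  also have "\<dots> = cofactor (?J (Suc n)) 0 n" by simp
  also have "mat_delete (?J (Suc n)) 0 n = ?J n"
    by (rule eq_matI) (auto simp: mat_delete_def)
  hence "cofactor (?J (Suc n)) 0 n = (- 1) ^ n * (- 1) ^ (n choose 2)"
    using Suc by (simp add: cofactor_def)
  also have "\<dots> = (- 1) ^ (Suc n choose 2)"
    by (simp add: numeral_2_eq_2 power_add)
  finally show ?case .
qed

text \<open>Every term of the Leibniz formula takes one factor from each row and each column, so the
  scalings come out without any division. This is how powers of the coordinate leave the
  Wronskian.\<close>

lemma det_scale_rows_cols:
  fixes r c :: "nat \<Rightarrow> 'a::comm_ring_1"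
  shows "det (mat n n (\<lambda>(i, j). r i * M i j * c j)) =
    (\<Prod>i<n. r i) * (\<Prod>i<n. c i) * det (mat n n (\<lambda>(i, j). M i j))"
proof -
  have "(\<Prod>i = 0..<n. mat n n (\<lambda>(i, j). r i * M i j * c j) $$ (i, p i)) =
      (\<Prod>i<n. r i) * (\<Prod>i<n. c i) * (\<Prod>i = 0..<n. mat n n (\<lambda>(i, j). M i j) $$ (i, p i))"
    if p: "p permutes {0..<n}" for p
  proof -
    have "(\<Prod>i = 0..<n. mat n n (\<lambda>(i, j). r i * M i j * c j) $$ (i, p i)) =
        (\<Prod>i = 0..<n. r i * M i (p i) * c (p i))"
      using p by (intro prod.cong) (auto simp: permutes_in_image)
    also have "\<dots> = (\<Prod>i = 0..<n. r i) * (\<Prod>i = 0..<n. M i (p i)) * (\<Prod>i = 0..<n. c (p i))"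
      by (simp add: prod.distrib)
    also have "(\<Prod>i = 0..<n. c (p i)) = (\<Prod>i = 0..<n. c i)"
      using prod.permute[OF p, of c] by (simp add: o_def)
    also have "(\<Prod>i = 0..<n. M i (p i)) = (\<Prod>i = 0..<n. mat n n (\<lambda>(i, j). M i j) $$ (i, p i))"
      using p by (intro prod.cong) (auto simp: permutes_in_image)
    finally show ?thesis by (simp add: atLeast0LessThan mult_ac)
  qed
  thus ?thesis
    unfolding det_def'[OF mat_carrier] sum_distrib_left
    by (intro sum.cong refl) (simp add: mult_ac)
qed

text \<open>Comparing coefficients in \<open>(1 + x)\<^sup>2\<^sup>m = (1 + (2 x + x\<^sup>2))\<^sup>m\<close> factors the matrix into two
  triangular ones.\<close>

lemma binomial_double:
  assumes "m \<le> l"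
  shows "(of_nat ((2 * m) choose i) :: 'a::comm_ring_1) =
    (\<Sum>k\<le>l. coeff ([:0, 2, 1:] ^ k) i * of_nat (m choose k))"
proof -
  have "[:1, 1 :: 'a:] ^ 2 = [:0, 2, 1:] + 1"
    by (simp add: power2_eq_square one_pCons)
  hence "[:1, 1 :: 'a:] ^ (2 * m) = ([:0, 2, 1:] + 1) ^ m"
    by (simp only: power_mult)
  also have "\<dots> = (\<Sum>k\<le>m. of_nat (m choose k) * [:0, 2, 1:] ^ k)"
    by (simp only: binomial_ring power_one mult_1_right)
  also have "\<dots> = (\<Sum>k\<le>l. of_nat (m choose k) * [:0, 2, 1:] ^ k)"
    using assms by (intro sum.mono_neutral_left) (auto simp: binomial_eq_0)
  finally have "coeff ([:1, 1 :: 'a:] ^ (2 * m)) i =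
      (\<Sum>k\<le>l. coeff (of_nat (m choose k) * [:0, 2, 1:] ^ k) i)"
    by (simp only: coeff_sum)
  moreover have "coeff ([:1, 1 :: 'a:] ^ (2 * m)) i = of_nat ((2 * m) choose i)"
  proof (cases "i \<le> 2 * m")
    case True
    thus ?thesis by (simp only: coeff_linear_poly_power power_one mult_1_right)
  next
    case False
    thus ?thesis
      by (simp add: binomial_eq_0 coeff_eq_0 degree_linear_power)
  qed
  moreover have "coeff (of_nat c * p) i = coeff p i * of_nat c" for c and p :: "'a poly"
    by (simp add: of_nat_poly)
  ultimately show ?thesis
    by (simp only:)
qed

text \<open>As \<open>2x + x^2 = x(2 + x)\<close>, its \<open>k\<close>-th power starts at
  \<open>x^k\<close> with coefficient \<open>2^k\<close>. Hence the coefficient matrix is lower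
  triangular with powers of 2 on the diagonal.\<close>

lemma coeff_power_low:
  "coeff ([:0, 2, 1 :: 'a::comm_ring_1:] ^ k) i = (if i < k then 0 else coeff ([:2, 1:] ^ k) (i - k))"
proof -
  have "[:0, 2, 1 :: 'a:] = [:0, 1:] * [:2, 1:]" by simp
  hence "[:0, 2, 1 :: 'a:] ^ k = [:0, 1:] ^ k * [:2, 1:] ^ k"
    by (simp only: power_mult_distrib)
  also have "[:0, 1 :: 'a:] ^ k = monom 1 k"
    by (simp only: monom_altdef smult_1_left)
  finally show ?thesis by (simp add: coeff_monom_mult)
qed

lemma prod_powers_choose: "(\<Prod>i<n. a ^ i) = (a :: 'a::comm_monoid_mult) ^ (n choose 2)"
  by (induction n) (simp_all add: numeral_2_eq_2 power_add mult.commute)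

lemma prod_list_map_upt: "prod_list (map f [0..<n]) = (\<Prod>i<n. f i :: 'a::comm_monoid_mult)"
  by (induction n) (simp_all add: mult.commute)

text \<open>The matrix is \<open>L * T * J\<close>, with \<open>L\<close> holding the coefficients
  of the powers of \<open>2x + x^2\<close>, \<open>T\<close> the unipotent Pascal matrix and
  \<open>J\<close> the reversal. The reversal is due to the exponent \<open>l - j\<close> in column
  \<open>j\<close>; it contributes the sign, and \<open>L\<close> the power of 2.\<close>

lemma det_binomial_double:
  "det (mat (Suc l) (Suc l) (\<lambda>(i, j). of_nat ((2 * (l - j)) choose i) :: 'a::comm_ring_1)) =
     (- 2) ^ (Suc l choose 2)"
proof -
  let ?n = "Suc l"
  let ?L = "mat ?n ?n (\<lambda>(i, k). coeff ([:0, 2, 1 :: 'a:] ^ k) i)"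
  let ?T = "mat ?n ?n (\<lambda>(k, j). of_nat (j choose k) :: 'a)"
  let ?J = "mat ?n ?n (\<lambda>(i, j). if i + j + 1 = ?n then 1 else 0 :: 'a)"
  have TJ: "?T * ?J = mat ?n ?n (\<lambda>(k, j). of_nat ((l - j) choose k))"
  proof (rule eq_matI, goal_cases)
    case (1 k j)
    hence "(?T * ?J) $$ (k, j) = (\<Sum>i<?n. of_nat (i choose k) * (if i + j + 1 = ?n then 1 else 0))"
      by (simp add: scalar_prod_def atLeast0LessThan del: sum.lessThan_Suc)
    also have "\<dots> = (\<Sum>i<?n. if i = l - j then of_nat (i choose k) else 0)"
      using 1 by (intro sum.cong) auto
    also have "\<dots> = of_nat ((l - j) choose k)" by (subst sum.delta) auto
    finally show ?case using 1 by simp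
  qed auto
  have "mat ?n ?n (\<lambda>(i, j). of_nat ((2 * (l - j)) choose i) :: 'a) = ?L * (?T * ?J)"
    unfolding TJ
  proof (rule eq_matI, goal_cases)
    case (1 i j)
    thus ?case
      using binomial_double[of "l - j" l i, where 'a = 'a]
      by (simp add: scalar_prod_def atLeast0LessThan lessThan_Suc_atMost del: sum.lessThan_Suc)
  qed auto
  also have "det \<dots> = det ?L * (det ?T * det ?J)"
    by (subst det_mult[of _ ?n], auto)+
  also have "det ?J = (- 1) ^ (?n choose 2)" by (rule det_reversal)
  also have "det ?T = prod_list (diag_mat ?T)"
    by (rule det_upper_triangular[of _ ?n]) (auto simp: upper_triangular_def binomial_eq_0)
  also have "diag_mat ?T = map (\<lambda>_. 1) [0..<?n]"
    by (simp add: diag_mat_def del: upt_Suc)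
  also have "prod_list \<dots> = (1 :: 'a)" by (simp only: prod_list_map_upt prod.neutral_const)
  also have "det ?L = prod_list (diag_mat ?L)"
    by (rule det_lower_triangular[of ?n]) (auto simp: coeff_power_low)
  also have "diag_mat ?L = map (\<lambda>i. 2 ^ i) [0..<?n]"
    by (simp add: diag_mat_def coeff_power_low coeff_0_power del: upt_Suc)
  also have "prod_list \<dots> = (2 :: 'a) ^ (?n choose 2)"
    by (simp only: prod_list_map_upt prod_powers_choose)
  finally show ?thesis
    unfolding power_minus[of "2 :: 'a"] by (simp only: mult_1_left mult.commute)
qed

section \<open>Wronskians and residue forms over power series\<close>

text \<open>Multiplying row \<open>i\<close> by \<open>X^i\<close> costs \<open>X^N\<close>, where
  \<open>N\<close> is the binomial coefficient in the statement; the columns then release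
  \<open>X^(2(l - j))\<close>, in total \<open>X^(2N)\<close>. The balance is \<open>X^N\<close>,
  and the remaining determinant has as constant term the binomial determinant scaled by powers of
  \<open>V(0)\<close>.\<close>

lemma fps_wronskian_leading_term:
  fixes V :: "'a::field fps"
  shows "\<exists>E. det (mat (Suc l) (Suc l) (\<lambda>(i, j). fps_hasse i ((fps_X ^ 2 * V) ^ (l - j)))) =
      fps_X ^ (Suc l choose 2) * E \<and> fps_nth E 0 = (- 2 * fps_nth V 0) ^ (Suc l choose 2)"
proof -
  let ?n = "Suc l"
  let ?Z = "fps_X ^ 2 * V"
  let ?N = "?n choose 2"
  define W where "W = det (mat ?n ?n (\<lambda>(i, j). fps_hasse i (?Z ^ (l - j))))"
  \<comment> \<open>\<open>X^i\<close> times the \<open>i\<close>-th derivative of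
    \<open>(X^2 V)^m\<close>, stripped of \<open>X^(2m)\<close>: coefficient \<open>n\<close> comes
    from degree \<open>n + 2m\<close>, whence the binomial.\<close>
  define E where "E i m = Abs_fps (\<lambda>n. of_nat ((n + 2 * m) choose i) * fps_nth (V ^ m) n)" for i m
  have E: "fps_X ^ i * fps_hasse i (?Z ^ m) = E i m * fps_X ^ (2 * m)" for i m
  proof (rule fps_ext)
    fix n
    have "?Z ^ m = fps_X ^ (2 * m) * V ^ m"
      by (simp add: power_mult_distrib power_mult)
    thus "fps_nth (fps_X ^ i * fps_hasse i (?Z ^ m)) n = fps_nth (E i m * fps_X ^ (2 * m)) n"
      unfolding fps_X_power_mult_hasse
      by (simp add: fps_X_power_mult_nth fps_X_power_mult_right_nth E_def)
  qed
  have rev: "(\<Prod>j<?n. a ^ (l - j)) = a ^ ?N" for a :: "'b::comm_monoid_mult"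
    using prod.nat_diff_reindex[of "\<lambda>i. a ^ i" ?n] prod_powers_choose[of a ?n] by simp
  have "fps_X ^ ?N * W = det (mat ?n ?n (\<lambda>(i, j). fps_X ^ i * fps_hasse i (?Z ^ (l - j)) * 1))"
    unfolding det_scale_rows_cols prod_powers_choose W_def by simp
  also have "\<dots> = det (mat ?n ?n (\<lambda>(i, j). 1 * E i (l - j) * (fps_X ^ 2) ^ (l - j)))"
    unfolding E by (simp add: power_mult)
  also have "\<dots> = fps_X ^ ?N * (fps_X ^ ?N * det (mat ?n ?n (\<lambda>(i, j). E i (l - j))))"
    unfolding det_scale_rows_cols rev
    by (simp add: power_mult[symmetric] mult_2 power_add mult.assoc)
  finally have W: "W = fps_X ^ ?N * det (mat ?n ?n (\<lambda>(i, j). E i (l - j)))"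
    by simp
  interpret ev: comm_ring_hom "\<lambda>f :: 'a fps. fps_nth f 0"
    by unfold_locales simp_all
  have "fps_nth (det (mat ?n ?n (\<lambda>(i, j). E i (l - j)))) 0 =
      det (map_mat (\<lambda>f. fps_nth f 0) (mat ?n ?n (\<lambda>(i, j). E i (l - j))))"
    by (rule ev.hom_det[symmetric])
  also have "map_mat (\<lambda>f. fps_nth f 0) (mat ?n ?n (\<lambda>(i, j). E i (l - j))) =
      mat ?n ?n (\<lambda>(i, j). 1 * of_nat ((2 * (l - j)) choose i) * fps_nth V 0 ^ (l - j))"
    by (rule eq_matI) (auto simp: E_def fps_nth_power_0)
  also have "det \<dots> = fps_nth V 0 ^ ?N * (- 2) ^ ?N"
    unfolding det_scale_rows_cols rev det_binomial_double by simp
  finally show ?thesis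
    using W unfolding W_def power_mult_distrib by (metis mult.commute)
qed

section \<open>Diagonalizing a residue form\<close>

lemma fps_sqrt_approx:
  fixes u :: "'a::field fps"
  assumes "(2 :: 'a) \<noteq> 0" "fps_nth u 0 = 1"
  shows "\<exists>s r. fps_nth s 0 = 1 \<and> u = s ^ 2 + fps_X ^ Suc n * r"
proof (induction n)
  case 0
  have "u = 1 ^ 2 + fps_X ^ Suc 0 * fps_shift 1 u"
    using assms(2) by (intro fps_ext) (auto simp: fps_X_mult_nth)
  moreover have "fps_nth (1 :: 'a fps) 0 = 1" by simp
  ultimately show ?case by blast
next
  case (Suc n)
  then obtain s r where s: "fps_nth s 0 = 1" and u: "u = s ^ 2 + fps_X ^ Suc n * r" by blast
  \<comment> \<open>Newton's correction adds half of the error to \<open>s\<close>. What remains is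
    the error times \<open>1 - s\<close>, divisible by one more \<open>X\<close>, and a square of
    order at least \<open>2n + 2\<close>. A truncated root suffices, since the form reads only
    finitely many coefficients.\<close>
  define c where "c = fps_const (1 / 2 :: 'a)"
  have c: "c + c = 1" using assms(1) by (simp add: c_def field_simps)
  define s' where "s' = s + c * (fps_X ^ Suc n * r)"
  define t where "t = fps_shift 1 (1 - s)"
  have t: "1 - s = fps_X * t"
    unfolding t_def using s by (intro fps_ext) (auto simp: fps_X_mult_nth)
  have "u - s' ^ 2 = fps_X ^ Suc n * r - (c + c) * s * (fps_X ^ Suc n * r) - (c * (fps_X ^ Suc n * r)) ^ 2"
    unfolding u s'_def by (simp add: power2_eq_square algebra_simps)
  also have "\<dots> = fps_X ^ Suc n * r * (1 - s) - (c * (fps_X ^ Suc n * r)) ^ 2"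
    unfolding c by (simp add: algebra_simps)
  also have "\<dots> = fps_X ^ Suc (Suc n) * (r * t - c ^ 2 * fps_X ^ n * r ^ 2)"
    unfolding t by (simp add: power2_eq_square algebra_simps)
  finally have "u = s' ^ 2 + fps_X ^ Suc (Suc n) * (r * t - c ^ 2 * fps_X ^ n * r ^ 2)"
    by (simp add: algebra_simps)
  moreover have "fps_nth s' 0 = 1" by (simp add: s'_def s)
  ultimately show ?case by blast
qed

text \<open>With \<open>v q^2\<close> equal to the constant \<open>c\<close> up to degree
  \<open>2K\<close>, the form on multiples of \<open>q\<close> pairs \<open>X^p\<close> only with
  \<open>X^(2K - p)\<close>. Each such pair with \<open>p < K\<close> splits into orthogonal vectors
  of values \<open>1\<close> and \<open>-1\<close>, stored at the indices \<open>2p\<close> and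
  \<open>2p + 1\<close>; the middle power \<open>X^K\<close> is left over at index
  \<open>2K\<close>. The parameter \<open>b\<close> rescales it, which changes its value by a
  square.\<close>

lemma residue_form_diagonal:
  fixes v :: "'a::field fps"
  assumes two: "(2 :: 'a) \<noteq> 0" and v: "fps_nth v 0 \<noteq> 0"
  shows "\<exists>f. \<forall>i\<le>2 * K. \<forall>j\<le>2 * K. fps_nth (v * f i * f j) (2 * K) =
    (if i = j then if i = 2 * K then fps_nth v 0 * b ^ 2 else (- 1) ^ i else 0)"
proof -
  define c where "c = fps_nth v 0"
  have c: "c \<noteq> 0" using v by (simp add: c_def)
  have "fps_nth (fps_const (1 / c) * v) 0 = 1" using c by (simp add: c_def)
  from fps_sqrt_approx[OF two this, of "2 * K"] obtain s r where s: "fps_nth s 0 = 1"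
    and sr: "fps_const (1 / c) * v = s ^ 2 + fps_X ^ Suc (2 * K) * r" by blast
  define q where "q = inverse s"
  have sq: "s * q = 1" using s inverse_mult_eq_1'[of s] by (simp add: q_def)
  have vq: "v * q ^ 2 = fps_const c * (1 + fps_X ^ Suc (2 * K) * (r * q ^ 2))"
  proof -
    have "fps_const c * (fps_const (1 / c) * v) * q ^ 2 =
        fps_const c * ((s * q) ^ 2 + fps_X ^ Suc (2 * K) * (r * q ^ 2))"
      unfolding sr by (simp add: power_mult_distrib algebra_simps)
    moreover have "fps_const c * (fps_const (1 / c) * v) = v"
      using c by (simp add: mult.assoc[symmetric])
    ultimately show ?thesis by (simp add: sq)
  qed
  have B: "fps_nth (v * q ^ 2 * fps_X ^ m) (2 * K) = (if m = 2 * K then c else 0)" for m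
  proof -
    have "v * q ^ 2 * fps_X ^ m = fps_const c * (fps_X ^ m + fps_X ^ Suc (2 * K) * (r * q ^ 2 * fps_X ^ m))"
      unfolding vq by (simp add: algebra_simps)
    thus ?thesis
      by (simp add: fps_X_power_mult_nth fps_X_power_nth del: power_Suc)
  qed
  define \<alpha> where "\<alpha> i = (if i = 2 * K then b else 1)" for i
  \<comment> \<open>The vector \<open>X^p + e X^(2K - p)\<close> has value \<open>2ec\<close>, which
    \<open>e = 1/(2c)\<close> or \<open>e = -1/(2c)\<close> normalizes to \<open>1\<close> or
    \<open>-1\<close>. At index \<open>2K\<close> both exponents equal \<open>K\<close>, so the
    second summand is switched off.\<close>
  define \<beta> where "\<beta> i = (if i = 2 * K then 0 else (- 1) ^ i / (2 * c))" for i
  define f where "f i = (fps_const (\<alpha> i) * fps_X ^ (i div 2) +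
      fps_const (\<beta> i) * fps_X ^ (2 * K - i div 2)) * q" for i
  have nth: "fps_nth (v * f i * f j) (2 * K) =
      (let p = i div 2; p' = j div 2 in
        \<alpha> i * \<alpha> j * (if p + p' = 2 * K then c else 0) +
        \<alpha> i * \<beta> j * (if p + (2 * K - p') = 2 * K then c else 0) +
        \<beta> i * \<alpha> j * (if (2 * K - p) + p' = 2 * K then c else 0) +
        \<beta> i * \<beta> j * (if (2 * K - p) + (2 * K - p') = 2 * K then c else 0))" for i j
  proof -
    have ring: "v * ((a * x + a' * y) * q) * ((e * x' + e' * y') * q) =
        a * e * (v * (q * q) * (x * x')) + a * e' * (v * (q * q) * (x * y')) +
        a' * e * (v * (q * q) * (y * x')) + a' * e' * (v * (q * q) * (y * y'))"
      for a a' e e' x x' y y' :: "'a fps"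
      by (simp add: algebra_simps)
    let ?p = "i div 2" and ?p' = "j div 2"
    have "v * f i * f j =
        fps_const (\<alpha> i * \<alpha> j) * (v * q ^ 2 * fps_X ^ (?p + ?p')) +
        fps_const (\<alpha> i * \<beta> j) * (v * q ^ 2 * fps_X ^ (?p + (2 * K - ?p'))) +
        fps_const (\<beta> i * \<alpha> j) * (v * q ^ 2 * fps_X ^ ((2 * K - ?p) + ?p')) +
        fps_const (\<beta> i * \<beta> j) * (v * q ^ 2 * fps_X ^ ((2 * K - ?p) + (2 * K - ?p')))"
      unfolding f_def power_add fps_const_mult[symmetric] power2_eq_square
      by (rule ring)
    thus ?thesis
      unfolding Let_def by (simp only: fps_add_nth fps_mult_left_const_nth B)
  qed
  have "fps_nth (v * f i * f j) (2 * K) =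
      (if i = j then if i = 2 * K then c * b ^ 2 else (- 1) ^ i else 0)"
    if i: "i \<le> 2 * K" and j: "j \<le> 2 * K" for i j
  proof -
    consider "i = 2 * K" "j = 2 * K" | "i < 2 * K" "j = 2 * K" | "i = 2 * K" "j < 2 * K"
      | "i < 2 * K" "j < 2 * K" using i j by linarith
    thus ?thesis
    proof cases
      case 1
      thus ?thesis unfolding nth Let_def
        by (simp add: \<alpha>_def \<beta>_def power2_eq_square)
    next
      case 2
      hence "i div 2 < K" by linarith
      with 2 show ?thesis unfolding nth Let_def by (simp add: \<beta>_def)
    next
      case 3
      hence "j div 2 < K" by linarith
      with 3 show ?thesis unfolding nth Let_def by (simp add: \<beta>_def)
    next
      case 4
      hence lt: "i div 2 < K" "j div 2 < K" by linarith+
      \<comment> \<open>Distinct indices with the same half are \<open>2p\<close> and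
        \<open>2p + 1\<close>; their signs are opposite, so the cross term cancels.\<close>
      have eq: "i = j \<or> i = Suc j \<and> even j \<or> j = Suc i \<and> even i" if "i div 2 = j div 2"
        using that by presburger
      show ?thesis
      proof (cases "i div 2 = j div 2")
        case True
        define p where "p = j div 2"
        have p: "i div 2 = p" "j div 2 = p" "p < K" using True lt by (simp_all add: p_def)
        have "p + p \<noteq> 2 * K" "p + (2 * K - p) = 2 * K" "2 * K - p + p = 2 * K"
          "2 * K - p + (2 * K - p) \<noteq> 2 * K" using p(3) by linarith+
        moreover have "\<alpha> i = 1" "\<alpha> j = 1" using 4 by (simp_all add: \<alpha>_def)
        ultimately have "fps_nth (v * f i * f j) (2 * K) = (\<beta> i + \<beta> j) * c"
          unfolding nth Let_def p by (simp add: algebra_simps)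
        also have "\<beta> i + \<beta> j = ((- 1) ^ i + (- 1) ^ j) / (2 * c)"
          using 4 by (simp add: \<beta>_def add_divide_distrib)
        also have "(- 1 :: 'a) ^ i + (- 1) ^ j = (if i = j then 2 * (- 1) ^ i else 0)"
          using eq[OF True] by auto
        finally show ?thesis using 4 c two by (cases "i = j") simp_all
      next
        case False
        moreover from this have "i div 2 + i div 2 \<noteq> 2 * K" "i div 2 + j div 2 \<noteq> 2 * K"
          "i div 2 + (2 * K - j div 2) \<noteq> 2 * K" "2 * K - i div 2 + j div 2 \<noteq> 2 * K"
          "2 * K - i div 2 + (2 * K - j div 2) \<noteq> 2 * K" using lt by linarith+
        ultimately show ?thesis using 4 unfolding nth Let_def by auto
      qed
    qed
  qed
  thus ?thesis unfolding c_def by blast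
qed

lemma residue_form_expand:
  fixes v :: "'a::comm_ring_1 fps"
  shows "fps_nth (v * f * h) m =
    (\<Sum>i\<le>m. \<Sum>j\<le>m. fps_nth f i * fps_nth (v * fps_X ^ (i + j)) m * fps_nth h j)"
proof -
  have one: "fps_nth (u * p) m = (\<Sum>i\<le>m. fps_nth p i * fps_nth (u * fps_X ^ i) m)" for u p :: "'a fps"
    unfolding mult.commute[of u p] fps_mult_nth[of p u]
    by (intro sum.cong) (auto simp: fps_X_power_mult_right_nth)
  have "fps_nth (v * f * h) m = (\<Sum>j\<le>m. fps_nth h j * fps_nth ((v * fps_X ^ j) * f) m)"
    unfolding one[of "v * f" h] by (simp only: mult_ac)
  also have "\<dots> = (\<Sum>j\<le>m. \<Sum>i\<le>m. fps_nth f i * fps_nth (v * fps_X ^ (i + j)) m * fps_nth h j)"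
    unfolding one[of "v * fps_X ^ _" f] sum_distrib_left
    by (simp only: mult_ac power_add)
  finally show ?thesis by (subst sum.swap)
qed

text \<open>The Gram matrix of \<open>(a, b) \<mapsto> Res (v a b / t\<^sup>n dt)\<close> on \<open>F[t]/(t\<^sup>n)\<close>.\<close>

definition residue_gram :: "nat \<Rightarrow> 'a::field fps \<Rightarrow> (nat \<Rightarrow> 'a fps) \<Rightarrow> 'a mat" where
  "residue_gram n v f = mat n n (\<lambda>(i, j). fps_nth (v * f i * f j) (n - 1))"

text \<open>The pairing factors through truncation at \<open>X^n\<close>, so passing from the powers
  of \<open>X\<close> to any family is congruence by the coefficient matrix of that family. Its
  invertibility is established separately in each application.\<close>

lemma residue_gram_congruence:
  fixes f :: "nat \<Rightarrow> 'a::field fps"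
  assumes "n > 0"
  defines "P \<equiv> mat n n (\<lambda>(i, j). fps_nth (f j) i)"
  shows "residue_gram n v f =
    transpose_mat P * residue_gram n v (\<lambda>i. fps_X ^ i) * P"
proof (rule eq_matI)
  fix i j assume "i < dim_row (transpose_mat P * residue_gram n v (\<lambda>i. fps_X ^ i) * P)"
    "j < dim_col (transpose_mat P * residue_gram n v (\<lambda>i. fps_X ^ i) * P)"
  hence ij: "i < n" "j < n" by (simp_all add: P_def)
  let ?G = "\<lambda>k m. fps_nth (v * fps_X ^ k * fps_X ^ m) (n - 1)"
  have "(transpose_mat P * residue_gram n v (\<lambda>i. fps_X ^ i) * P) $$ (i, j) =
      (\<Sum>m<n. (\<Sum>k<n. fps_nth (f i) k * ?G k m) * fps_nth (f j) m)"
    using ij by (simp add: P_def residue_gram_def scalar_prod_def atLeast0LessThan)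
  also have "\<dots> = (\<Sum>k<n. \<Sum>m<n. fps_nth (f i) k * ?G k m * fps_nth (f j) m)"
    unfolding sum_distrib_right by (rule sum.swap)
  also have "{..<n} = {..n - 1}" using assms(1) by auto
  also have "(\<Sum>k\<le>n - 1. \<Sum>m\<le>n - 1. fps_nth (f i) k * ?G k m * fps_nth (f j) m) =
      fps_nth (v * f i * f j) (n - 1)"
    unfolding residue_form_expand[of v "f i" "f j"] power_add by (simp only: mult.assoc)
  also have "\<dots> = residue_gram n v f $$ (i, j)"
    using ij by (simp add: residue_gram_def)
  finally show "residue_gram n v f $$ (i, j) =
    (transpose_mat P * residue_gram n v (\<lambda>i. fps_X ^ i) * P) $$ (i, j)" ..
qed (simp_all add: P_def residue_gram_def)

section \<open>Classes of diagonal and residue forms in the Grothendieck--Witt group\<close>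

lemma gw_form_isometric:
  assumes "isometric A B"
  shows "gw_form A = gw_form B"
proof -
  have "abs_form_class A = abs_form_class B"
    using Quotient3_rel_abs[OF Quotient3_form_class assms] .
  thus ?thesis by (simp add: gw_form_def)
qed

lemma gw_form_orth_sum:
  assumes "nondeg_sym A" "nondeg_sym B"
  shows "gw_form (orth_sum A B) = gw_form A + gw_form B"
  unfolding gw_form_def plus_gw.abs_eq fst_conv snd_conv
    plus_form_class.abs_eq[OF isometric_refl[OF assms(1)] isometric_refl[OF assms(2)]]
  by simp

lemma det_diagonal:
  "det (mat n n (\<lambda>(i, j). if i = j then d i else 0)) = (\<Prod>i<n. d i :: 'a::comm_ring_1)"
proof -
  have "mat n n (\<lambda>(i, j). if i = j then d i else 0) =
      mat n n (\<lambda>(i, j). d i * (if i = j then 1 else 0) * 1)"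
    by (rule eq_matI) auto
  also have "det \<dots> = (\<Prod>i<n. d i)"
    unfolding det_scale_rows_cols one_mat_def[symmetric] by simp
  finally show ?thesis .
qed

lemma nondeg_sym_diagonal:
  assumes "\<And>i. i < n \<Longrightarrow> d i \<noteq> (0 :: 'a::field)"
  shows "nondeg_sym (mat n n (\<lambda>(i, j). if i = j then d i else 0))"
  unfolding nondeg_sym_def det_diagonal using assms by (auto intro!: eq_matI)

lemma gw_form_diagonal:
  assumes "\<And>i. i < n \<Longrightarrow> d i \<noteq> (0 :: 'a::field)"
  shows "gw_form (mat n n (\<lambda>(i, j). if i = j then d i else 0)) = (\<Sum>i<n. gw_unit (d i))"
  using assms
proof (induction n)
  case 0
  have "mat 0 0 (\<lambda>(i, j). if i = j then d i else 0) = 1\<^sub>m 0" by (rule eq_matI) auto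
  thus ?case by (simp add: gw_form_def zero_gw_def zero_form_class_def)
next
  case (Suc n)
  let ?D = "\<lambda>n. mat n n (\<lambda>(i, j). if i = j then d i else 0)"
  have "?D (Suc n) = orth_sum (?D n) (mat 1 1 (\<lambda>_. d n))"
    unfolding orth_sum_def by (rule eq_matI) (auto simp: less_Suc_eq)
  moreover have "nondeg_sym (?D n)" by (rule nondeg_sym_diagonal) (simp add: Suc.prems)
  moreover have "nondeg_sym (mat 1 1 (\<lambda>_. d n))"
    using Suc.prems[of n] by (auto simp: nondeg_sym_def det_single intro!: eq_matI)
  ultimately have "gw_form (?D (Suc n)) = gw_form (?D n) + gw_unit (d n)"
    by (simp only: gw_form_orth_sum gw_unit_def)
  with Suc show ?case by simp
qed

lemma sum_gw_unit_alternating: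
  "(\<Sum>i<2 * K. gw_unit ((- 1) ^ i :: 'a::field)) = (\<Sum>_<K. gw_hyperbolic)"
  by (induction K) (simp_all add: gw_hyperbolic_def add_ac)

lemma
  fixes v :: "'a::field fps"
  assumes two: "(2 :: 'a) \<noteq> 0" and v: "fps_nth v 0 \<noteq> 0"
  shows nondeg_sym_residue_gram: "nondeg_sym (residue_gram (2 * K + 1) v (\<lambda>i. fps_X ^ i))"
    and gw_form_residue_gram: "b \<noteq> 0 \<Longrightarrow> gw_form (residue_gram (2 * K + 1) v (\<lambda>i. fps_X ^ i)) =
      (\<Sum>_<K. gw_hyperbolic) + gw_unit (fps_nth v 0 * b ^ 2)"
proof -
  let ?n = "2 * K + 1"
  let ?G = "residue_gram ?n v (\<lambda>i. fps_X ^ i)"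
  have G: "?G \<in> carrier_mat ?n ?n" by (simp add: residue_gram_def)
  have sym: "transpose_mat ?G = ?G"
    by (rule eq_matI) (auto simp: residue_gram_def mult_ac)
  have *: "nondeg_sym ?G \<and> gw_form ?G = (\<Sum>_<K. gw_hyperbolic) + gw_unit (fps_nth v 0 * b ^ 2)"
    if b: "b \<noteq> 0" for b
  proof -
    define d where "d i = (if i = 2 * K then fps_nth v 0 * b ^ 2 else (- 1) ^ i)" for i
    let ?D = "mat ?n ?n (\<lambda>(i, j). if i = j then d i else 0)"
    obtain f where f: "\<forall>i\<le>2 * K. \<forall>j\<le>2 * K. fps_nth (v * f i * f j) (2 * K) =
        (if i = j then if i = 2 * K then fps_nth v 0 * b ^ 2 else (- 1) ^ i else 0)"
      using residue_form_diagonal[OF two v] by blast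
    have D: "residue_gram ?n v f = ?D"
      by (rule eq_matI) (use f in \<open>auto simp: residue_gram_def d_def\<close>)
    define P where "P = mat ?n ?n (\<lambda>(i, j). fps_nth (f j) i)"
    have P: "P \<in> carrier_mat ?n ?n" and Pt: "transpose_mat P \<in> carrier_mat ?n ?n"
      by (simp_all add: P_def)
    have eq: "?D = transpose_mat P * ?G * P"
      unfolding D[symmetric] P_def by (rule residue_gram_congruence) simp
    have d: "d i \<noteq> 0" for i using v b by (simp add: d_def)
    have nD: "nondeg_sym ?D" by (rule nondeg_sym_diagonal) (rule d)
    \<comment> \<open>Read backwards, the congruence shows both that \<open>f\<close> gives a basis
      and that the form is nondegenerate: the diagonal determinant is nonzero, hence so is each
      factor.\<close>
    have "det ?D = det P * det ?G * det P"
      unfolding eq det_mult[OF mult_carrier_mat[OF Pt G] P]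
        det_mult[OF Pt G] det_transpose[OF P] ..
    with nD have nz: "det P \<noteq> 0" "det ?G \<noteq> 0" by (auto simp: nondeg_sym_def)
    have nG: "nondeg_sym ?G" unfolding nondeg_sym_def using G sym nz by auto
    have "isometric ?G ?D"
      by (rule isometricI[OF nG _ nz(1) eq]) (use P G in simp)
    hence "gw_form ?G = (\<Sum>i<?n. gw_unit (d i))"
      unfolding gw_form_diagonal[OF d, symmetric] by (rule gw_form_isometric)
    also have "\<dots> = (\<Sum>i<2 * K. gw_unit ((- 1) ^ i)) + gw_unit (fps_nth v 0 * b ^ 2)"
      by (simp add: d_def)
    finally show ?thesis using nG unfolding sum_gw_unit_alternating by blast
  qed
  from *[of 1] show "nondeg_sym ?G" by simp
  from * show "b \<noteq> 0 \<Longrightarrow> gw_form ?G = (\<Sum>_<K. gw_hyperbolic) + gw_unit (fps_nth v 0 * b ^ 2)" by blast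
qed

section \<open>Taylor expansion in a uniformizer\<close>

context field_hom
begin

lemma eval1_0 [simp]: "eval1 hom 0 u = 0"
  by (simp add: eval1_def)

lemma eval1_pCons [simp]: "eval1 hom (pCons c p) u = hom c + u * eval1 hom p u"
  by (simp add: eval1_def Polynomial.map_poly_pCons)

lemma eval1_1 [simp]: "eval1 hom 1 u = 1"
  by (simp add: one_pCons)

lemma eval1_add: "eval1 hom (p + q) u = eval1 hom p u + eval1 hom q u"
  by (induction p q rule: poly_induct2) (simp_all add: hom_add algebra_simps)

lemma eval1_smult: "eval1 hom (smult c p) u = hom c * eval1 hom p u"
  by (induction p) (simp_all add: hom_mult algebra_simps)

lemma eval1_mult: "eval1 hom (p * q) u = eval1 hom p u * eval1 hom q u"
  by (induction p) (simp_all add: eval1_add eval1_smult algebra_simps)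

lemma eval1_minus: "eval1 hom (- p) u = - eval1 hom p u"
  using eval1_add[of p "- p" u] by (simp add: eq_neg_iff_add_eq_0 add.commute)

lemma eval1_diff: "eval1 hom (p - q) u = eval1 hom p u - eval1 hom q u"
  using eval1_add[of p "- q" u] by (simp add: eval1_minus)

lemma eval1_monom: "eval1 hom (monom c n) u = hom c * u ^ n"
  by (induction n) (simp_all add: monom_0 monom_Suc)

lemma eval1_sum: "eval1 hom (sum p A) u = (\<Sum>i\<in>A. eval1 hom (p i) u)"
  by (induction A rule: infinite_finite_induct) (simp_all add: eval1_add)

end

text \<open>A local ring with coefficient field \<open>\<iota>(F)\<close> and uniformizer \<open>w\<close>.\<close>

locale uniformized_ring = field_hom \<iota> for \<iota> :: "'a::field \<Rightarrow> 'k::field" +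
  fixes R :: "'k set" and w :: 'k
  assumes const_mem: "\<iota> c \<in> R"
    and add_mem: "a \<in> R \<Longrightarrow> b \<in> R \<Longrightarrow> a + b \<in> R"
    and mult_mem: "a \<in> R \<Longrightarrow> b \<in> R \<Longrightarrow> a * b \<in> R"
    and uniformizer_mem: "w \<in> R"
    and uniformizer_nonzero: "w \<noteq> 0"
    and split_const: "a \<in> R \<Longrightarrow> \<exists>c. \<exists>b\<in>R. a = \<iota> c + w * b"
    and uniformizer_no_unit: "b \<in> R \<Longrightarrow> w * b \<noteq> 1"
    and inverse_const_mem: "c \<noteq> 0 \<Longrightarrow> b \<in> R \<Longrightarrow> inverse (\<iota> c + w * b) \<in> R"
    and separated: "a \<in> R \<Longrightarrow> (\<And>n. \<exists>b\<in>R. a = w ^ n * b) \<Longrightarrow> a = 0"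
begin

lemma zero_mem: "0 \<in> R" and one_mem: "1 \<in> R"
  using const_mem[of 0] const_mem[of 1] by simp_all

lemma uminus_mem: "a \<in> R \<Longrightarrow> - a \<in> R"
  using mult_mem[OF const_mem[of "- 1"], of a] by (simp add: hom_uminus)

lemma diff_mem: "a \<in> R \<Longrightarrow> b \<in> R \<Longrightarrow> a - b \<in> R"
  using add_mem[OF _ uminus_mem, of a b] by simp

lemma sum_mem: "(\<And>i. i \<in> A \<Longrightarrow> f i \<in> R) \<Longrightarrow> sum f A \<in> R"
  by (induction A rule: infinite_finite_induct) (auto intro: zero_mem add_mem)

lemma prod_mem: "(\<And>i. i \<in> A \<Longrightarrow> f i \<in> R) \<Longrightarrow> prod f A \<in> R"
  by (induction A rule: infinite_finite_induct) (auto intro: one_mem mult_mem)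

lemma power_mem: "a \<in> R \<Longrightarrow> a ^ n \<in> R"
  by (induction n) (auto intro: one_mem mult_mem)

lemma of_nat_mem: "of_nat n \<in> R"
  using const_mem[of "of_nat n"] by (simp add: hom_of_nat)

lemma eval1_mem: "a \<in> R \<Longrightarrow> eval1 \<iota> p a \<in> R"
  by (induction p) (auto intro: zero_mem add_mem mult_mem const_mem)

text \<open>Agreement with a power series is stated modulo every \<open>w^n\<close>, which avoids a
  completion. The polynomial \<open>q\<close> may change with \<open>n\<close> and have any degree;
  only its coefficients below \<open>n\<close> are compared.\<close>

definition expands :: "'k \<Rightarrow> 'a fps \<Rightarrow> bool" where
  "expands a s \<longleftrightarrow> (\<forall>n. \<exists>q. \<exists>b\<in>R. a = eval1 \<iota> q w + w ^ n * b \<and> (\<forall>i<n. coeff q i = fps_nth s i))"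

definition taylor :: "'k \<Rightarrow> 'a fps" where
  "taylor a = (THE s. expands a s)"

text \<open>A nonzero constant coefficient \<open>c\<close> would make \<open>w\<close> invertible,
  since \<open>w\<close> times \<open>-a/c\<close> would be \<open>1\<close>. So
  \<open>c = 0\<close>, one factor \<open>w\<close> cancels, and the induction continues.\<close>

lemma coeff_low_eq_0:
  assumes "eval1 \<iota> q w + w ^ n * b = 0" "b \<in> R" "i < n"
  shows "coeff q i = 0"
  using assms
proof (induction n arbitrary: q i)
  case (Suc n)
  obtain c p where q: "q = pCons c p" by (cases q)
  define a where "a = eval1 \<iota> p w + w ^ n * b"
  have aR: "a \<in> R" unfolding a_def
    by (intro add_mem mult_mem power_mem eval1_mem uniformizer_mem Suc.prems)
  have eq: "\<iota> c + w * a = 0" using Suc.prems(1) by (simp add: q a_def algebra_simps)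
  have "c = 0"
  proof (rule ccontr)
    assume "c \<noteq> 0"
    have "w * (- a * \<iota> (inverse c)) = \<iota> c * \<iota> (inverse c) - (\<iota> c + w * a) * \<iota> (inverse c)"
      by (simp add: algebra_simps)
    also have "\<dots> = \<iota> (c * inverse c)" unfolding eq by (simp add: hom_mult)
    also have "\<dots> = 1" using \<open>c \<noteq> 0\<close> by simp
    finally have "w * (- a * \<iota> (inverse c)) = 1" .
    moreover have "- a * \<iota> (inverse c) \<in> R" by (intro mult_mem uminus_mem aR const_mem)
    ultimately show False using uniformizer_no_unit by blast
  qed
  hence "a = 0" using eq uniformizer_nonzero by simp
  from Suc.IH[OF this[unfolded a_def] Suc.prems(2)] \<open>c = 0\<close> Suc.prems(3) show ?case
    by (cases i) (auto simp: q)
qed simp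

lemma truncation:
  assumes "a \<in> R"
  shows "\<exists>q. \<exists>b\<in>R. a = eval1 \<iota> q w + w ^ n * b"
proof (induction n)
  case 0
  show ?case using assms by (intro exI[of _ 0] bexI[of _ a]) auto
next
  case (Suc n)
  then obtain q b where b: "b \<in> R" "a = eval1 \<iota> q w + w ^ n * b" by blast
  from split_const[OF b(1)] obtain c b' where b': "b' \<in> R" "b = \<iota> c + w * b'" by blast
  have "a = eval1 \<iota> (q + monom c n) w + w ^ Suc n * b'"
    by (simp add: b b' eval1_add eval1_monom algebra_simps)
  with b' show ?case by blast
qed

lemma truncation_unique:
  assumes "eval1 \<iota> q w + w ^ n * b = eval1 \<iota> q' w + w ^ m * b'" "b \<in> R" "b' \<in> R" "i < n" "i < m"
  shows "coeff q i = coeff q' i"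
proof -
  \<comment> \<open>Both remainders are weakened to order \<open>i + 1\<close>, the least that still
    determines coefficient \<open>i\<close>.\<close>
  define k where "k = Suc i"
  have n: "w ^ n = w ^ k * w ^ (n - k)" and m: "w ^ m = w ^ k * w ^ (m - k)"
    using assms(4,5) unfolding k_def power_add[symmetric] by simp_all
  have "eval1 \<iota> (q - q') w + w ^ k * (w ^ (n - k) * b - w ^ (m - k) * b') = 0"
    using assms(1) unfolding n m by (simp add: eval1_diff algebra_simps)
  moreover have "w ^ (n - k) * b - w ^ (m - k) * b' \<in> R"
    by (intro diff_mem mult_mem power_mem uniformizer_mem assms)
  ultimately have "coeff (q - q') i = 0" by (rule coeff_low_eq_0) (simp add: k_def)
  thus ?thesis by simp
qed

lemma expands_unique:
  assumes "expands a s" "expands a s'"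
  shows "s = s'"
proof (rule fps_ext)
  fix i
  obtain q b where q: "b \<in> R" "a = eval1 \<iota> q w + w ^ Suc i * b" "\<forall>j<Suc i. coeff q j = fps_nth s j"
    using assms(1) unfolding expands_def by metis
  obtain q' b' where q': "b' \<in> R" "a = eval1 \<iota> q' w + w ^ Suc i * b'" "\<forall>j<Suc i. coeff q' j = fps_nth s' j"
    using assms(2) unfolding expands_def by metis
  have "coeff q i = coeff q' i"
    by (rule truncation_unique[of _ "Suc i" b _ "Suc i" b']) (use q q' in auto)
  with q q' show "fps_nth s i = fps_nth s' i" by auto
qed

lemma expands_exists:
  assumes "a \<in> R"
  shows "\<exists>s. expands a s"
proof -
  from truncation[OF assms] obtain q b
    where qb: "\<And>n :: nat. b n \<in> R" "\<And>n :: nat. a = eval1 \<iota> (q n) w + w ^ n * b n" by metis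
  have "expands a (Abs_fps (\<lambda>i. coeff (q (Suc i)) i))"
    unfolding expands_def
  proof (intro allI exI bexI conjI impI)
    fix n i :: nat assume "i < n"
    have "coeff (q n) i = coeff (q (Suc i)) i"
      by (rule truncation_unique[OF trans[OF qb(2)[symmetric] qb(2)] qb(1) qb(1) \<open>i < n\<close>]) simp
    thus "coeff (q n) i = fps_nth (Abs_fps (\<lambda>i. coeff (q (Suc i)) i)) i" by simp
  qed (use qb in auto)
  thus ?thesis by blast
qed

lemma expands_taylor: "a \<in> R \<Longrightarrow> expands a (taylor a)"
  unfolding taylor_def using expands_exists expands_unique by (metis theI)

lemma taylor_eqI: "expands a s \<Longrightarrow> taylor a = s"
  unfolding taylor_def using expands_unique by blast

lemma taylorE:
  assumes "a \<in> R"
  obtains q b where "b \<in> R" "a = eval1 \<iota> q w + w ^ n * b" "\<And>i. i < n \<Longrightarrow> coeff q i = fps_nth (taylor a) i"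
  using expands_taylor[OF assms] unfolding expands_def by metis

lemma taylor_add:
  assumes "a \<in> R" "b \<in> R"
  shows "taylor (a + b) = taylor a + taylor b"
proof (rule taylor_eqI, unfold expands_def, intro allI)
  fix n
  obtain q c where q: "c \<in> R" "a = eval1 \<iota> q w + w ^ n * c" "\<And>i. i < n \<Longrightarrow> coeff q i = fps_nth (taylor a) i"
    using taylorE[OF assms(1)] by metis
  obtain q' c' where q': "c' \<in> R" "b = eval1 \<iota> q' w + w ^ n * c'" "\<And>i. i < n \<Longrightarrow> coeff q' i = fps_nth (taylor b) i"
    using taylorE[OF assms(2)] by metis
  show "\<exists>q. \<exists>d\<in>R. a + b = eval1 \<iota> q w + w ^ n * d \<and> (\<forall>i<n. coeff q i = fps_nth (taylor a + taylor b) i)"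
    by (intro exI[of _ "q + q'"] bexI[of _ "c + c'"] add_mem conjI q(1) q'(1))
      (simp_all add: q(3) q'(3) eval1_add algebra_simps, simp add: q(2) q'(2) algebra_simps)
qed

lemma taylor_mult:
  assumes "a \<in> R" "b \<in> R"
  shows "taylor (a * b) = taylor a * taylor b"
proof (rule taylor_eqI, unfold expands_def, intro allI)
  fix n
  obtain q c where q: "c \<in> R" "a = eval1 \<iota> q w + w ^ n * c" "\<And>i. i < n \<Longrightarrow> coeff q i = fps_nth (taylor a) i"
    using taylorE[OF assms(1)] by metis
  obtain q' c' where q': "c' \<in> R" "b = eval1 \<iota> q' w + w ^ n * c'" "\<And>i. i < n \<Longrightarrow> coeff q' i = fps_nth (taylor b) i"
    using taylorE[OF assms(2)] by metis
  let ?d = "eval1 \<iota> q w * c' + c * b"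
  have "a * b = eval1 \<iota> (q * q') w + w ^ n * ?d"
    by (subst q(2), subst (1) q'(2)) (simp add: eval1_mult algebra_simps, simp add: q'(2) algebra_simps)
  moreover have "?d \<in> R" by (intro add_mem mult_mem eval1_mem uniformizer_mem q(1) q'(1) assms)
  moreover have "\<forall>i<n. coeff (q * q') i = fps_nth (taylor a * taylor b) i"
    using q(3) q'(3) by (auto simp: coeff_mult fps_mult_nth atMost_atLeast0 intro!: sum.cong)
  ultimately show "\<exists>q. \<exists>d\<in>R. a * b = eval1 \<iota> q w + w ^ n * d \<and>
      (\<forall>i<n. coeff q i = fps_nth (taylor a * taylor b) i)" by blast
qed

lemma taylor_eval1_uniformizer: "taylor (eval1 \<iota> q w) = fps_of_poly q"
  by (rule taylor_eqI, unfold expands_def)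
    (auto intro!: exI[of _ q] bexI[of _ 0] zero_mem)

lemma taylor_const: "taylor (\<iota> c) = fps_const c"
  using taylor_eval1_uniformizer[of "[:c:]"] by (simp add: fps_of_poly_const)

lemma taylor_0 [simp]: "taylor 0 = 0" and taylor_1 [simp]: "taylor 1 = 1"
  using taylor_const[of 0] taylor_const[of 1] by simp_all

lemma taylor_of_nat: "taylor (of_nat n) = of_nat n"
  using taylor_const[of "of_nat n"] by (simp add: fps_of_nat hom_of_nat)

lemma taylor_of_int: "taylor (of_int n) = of_int n"
  using taylor_const[of "of_int n"] by (simp add: fps_of_int hom_of_int)

lemma of_int_mem: "of_int n \<in> R"
  using const_mem[of "of_int n"] by (simp add: hom_of_int)

lemma taylor_uniformizer: "taylor w = fps_X"
  using taylor_eval1_uniformizer[of "[:0, 1:]"] by (simp add: fps_of_poly_pCons)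

lemma taylor_uminus: "a \<in> R \<Longrightarrow> taylor (- a) = - taylor a"
  using taylor_add[OF _ uminus_mem, of a a] by (simp add: eq_neg_iff_add_eq_0 add.commute)

lemma taylor_diff: "a \<in> R \<Longrightarrow> b \<in> R \<Longrightarrow> taylor (a - b) = taylor a - taylor b"
  using taylor_add[OF _ uminus_mem, of a b] by (simp add: taylor_uminus)

lemma taylor_sum: "(\<And>i. i \<in> A \<Longrightarrow> f i \<in> R) \<Longrightarrow> taylor (sum f A) = (\<Sum>i\<in>A. taylor (f i))"
  by (induction A rule: infinite_finite_induct) (simp_all add: taylor_add sum_mem)

lemma taylor_prod: "(\<And>i. i \<in> A \<Longrightarrow> f i \<in> R) \<Longrightarrow> taylor (prod f A) = (\<Prod>i\<in>A. taylor (f i))"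
  by (induction A rule: infinite_finite_induct) (simp_all add: taylor_mult prod_mem)

lemma taylor_power: "a \<in> R \<Longrightarrow> taylor (a ^ n) = taylor a ^ n"
  by (induction n) (simp_all add: taylor_mult power_mem)

text \<open>The bridge between ideals and coefficients: through it, membership in
  \<open>(w^n)\<close> is tested on expansions.\<close>

lemma taylor_low_eq_0_iff:
  assumes "a \<in> R"
  shows "(\<forall>i<n. fps_nth (taylor a) i = 0) \<longleftrightarrow> (\<exists>b\<in>R. a = w ^ n * b)"
proof
  assume *: "\<forall>i<n. fps_nth (taylor a) i = 0"
  obtain q b where q: "b \<in> R" "a = eval1 \<iota> q w + w ^ n * b" "\<And>i. i < n \<Longrightarrow> coeff q i = fps_nth (taylor a) i"
    using taylorE[OF assms] by metis
  hence "monom 1 n dvd q" using * by (simp add: monom_1_dvd_iff')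
  then obtain p where "q = monom 1 n * p" by (elim dvdE)
  hence "a = w ^ n * (eval1 \<iota> p w + b)"
    using q(2) by (simp add: eval1_mult eval1_monom algebra_simps)
  moreover have "eval1 \<iota> p w + b \<in> R" by (intro add_mem eval1_mem uniformizer_mem q)
  ultimately show "\<exists>b\<in>R. a = w ^ n * b" by blast
next
  assume "\<exists>b\<in>R. a = w ^ n * b"
  then obtain b where "b \<in> R" "a = w ^ n * b" by blast
  hence "taylor a = fps_X ^ n * taylor b"
    by (simp add: taylor_mult taylor_power power_mem uniformizer_mem taylor_uniformizer)
  thus "\<forall>i<n. fps_nth (taylor a) i = 0" by (simp add: fps_X_power_mult_nth)
qed

text \<open>A vanishing expansion puts \<open>a\<close> into every \<open>(w^n)\<close>, and
  \<open>separated\<close> gives \<open>a = 0\<close>. The resulting injectivity carries identities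
  of series back to functions.\<close>

lemma taylor_eq_0: "a \<in> R \<Longrightarrow> taylor a = 0 \<Longrightarrow> a = 0"
  by (rule separated) (auto simp flip: taylor_low_eq_0_iff)

lemma taylor_inject: "a \<in> R \<Longrightarrow> b \<in> R \<Longrightarrow> taylor a = taylor b \<Longrightarrow> a = b"
  using taylor_eq_0[of "a - b"] by (simp add: taylor_diff diff_mem)

lemma inverse_mem:
  assumes "a \<in> R" "fps_nth (taylor a) 0 \<noteq> 0"
  shows "inverse a \<in> R"
proof -
  from split_const[OF assms(1)] obtain c b where b: "b \<in> R" "a = \<iota> c + w * b" by blast
  hence "fps_nth (taylor a) 0 = c"
    by (simp add: taylor_add taylor_mult taylor_const taylor_uniformizer const_mem mult_mem uniformizer_mem)
  with assms(2) b show ?thesis using inverse_const_mem by auto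
qed

lemma taylor_nth_0_neq_0:
  assumes "fps_nth (taylor a) 0 \<noteq> 0"
  shows "a \<noteq> 0"
  using assms by auto

lemma taylor_eval1_nth_0:
  assumes "a \<in> R"
  shows "fps_nth (taylor (eval1 \<iota> p a)) 0 = poly p (fps_nth (taylor a) 0)"
  by (induction p)
    (simp_all add: assms taylor_add taylor_mult taylor_const const_mem mult_mem eval1_mem)

text \<open>\<open>taylor\<close> is a homomorphism only on the subset \<open>R\<close>, not on the
  whole field; hence the argument through the Leibniz formula, tracking membership term by
  term.\<close>

lemma det_mem:
  assumes "\<And>i j. i < n \<Longrightarrow> j < n \<Longrightarrow> M i j \<in> R"
  shows "det (mat n n (\<lambda>(i, j). M i j)) \<in> R"
    and "taylor (det (mat n n (\<lambda>(i, j). M i j))) = det (mat n n (\<lambda>(i, j). taylor (M i j)))"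
proof -
  have mem: "M i (p i) \<in> R" if "p permutes {0..<n}" "i \<in> {0..<n}" for p i
    using that assms permutes_in_image[OF that(1), of i] by simp
  have nth: "mat n n (\<lambda>(i, j). N i j) $$ (i, p i) = N i (p i)"
    if "p permutes {0..<n}" "i \<in> {0..<n}" for p i and N :: "nat \<Rightarrow> nat \<Rightarrow> 'b"
    using that permutes_in_image[OF that(1), of i] by simp
  have pm: "(\<Prod>i = 0..<n. M i (p i)) \<in> R" if "p permutes {0..<n}" for p
    by (rule prod_mem) (rule mem[OF that])
  have det: "det (mat n n (\<lambda>(i, j). N i j)) =
      (\<Sum>p | p permutes {0..<n}. signof p * (\<Prod>i = 0..<n. N i (p i)))"
    for N :: "nat \<Rightarrow> nat \<Rightarrow> 'b::comm_ring_1"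
    unfolding det_def'[OF mat_carrier]
    by (intro sum.cong arg_cong2[of _ _ _ _ "(*)"] prod.cong refl nth) auto
  show "det (mat n n (\<lambda>(i, j). M i j)) \<in> R"
    unfolding det by (intro sum_mem mult_mem of_int_mem) (use pm in auto)
  have tp: "taylor (\<Prod>i = 0..<n. M i (p i)) = (\<Prod>i = 0..<n. taylor (M i (p i)))"
    if "p permutes {0..<n}" for p
    by (rule taylor_prod) (rule mem[OF that])
  show "taylor (det (mat n n (\<lambda>(i, j). M i j))) = det (mat n n (\<lambda>(i, j). taylor (M i j)))"
    unfolding det
    by (subst taylor_sum)
      (auto intro!: sum.cong mult_mem of_int_mem pm simp: taylor_mult of_int_mem pm taylor_of_int tp)
qed

end

section \<open>Hasse derivatives and the Euler index through Taylor expansions\<close>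

text \<open>As \<open>R\<close> need not be complete, the derivative of an expansion could fail to
  be an expansion. The assumption excludes this and thereby supplies the existence of Hasse
  derivatives on \<open>R\<close>.\<close>

locale hasse_ring = uniformized_ring +
  assumes hasse_closed: "a \<in> R \<Longrightarrow> \<exists>b\<in>R. taylor b = fps_hasse k (taylor a)"
begin

text \<open>The axioms determine \<open>D\<close> on polynomials in \<open>w\<close>. By the Leibniz
  rule, \<open>D k\<close> lowers the \<open>w\<close>-adic order by at most \<open>k\<close>, so a
  polynomial truncation of \<open>a\<close> decides each coefficient. This continuity is what makes
  Hasse derivatives unique.\<close>

lemma hasse_system_taylor:
  assumes D: "hasse_system \<iota> R w D" and a: "a \<in> R"
  shows "taylor (D k a) = fps_hasse k (taylor a)"
proof -
  have mem: "D k a \<in> R" if "a \<in> R" for k a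
    using D that unfolding hasse_system_def by (blast intro: PiE_mem)
  have add: "D k (a + b) = D k a + D k b" if "a \<in> R" "b \<in> R" for k a b
    using D that unfolding hasse_system_def by blast
  have scale: "D k (\<iota> c * a) = \<iota> c * D k a" if "a \<in> R" for k a c
    using D that unfolding hasse_system_def by blast
  have leibniz: "D k (a * b) = (\<Sum>i\<le>k. D i a * D (k - i) b)" if "a \<in> R" "b \<in> R" for k a b
    using D that unfolding hasse_system_def by blast
  have power: "D k (w ^ n) = of_nat (n choose k) * w ^ (n - k)" for k n
    using D unfolding hasse_system_def by blast
  \<comment> \<open>All orders are collected at once, because the Leibniz rule for one order
    involves every lower one.\<close>
  define S where "S = {a \<in> R. \<forall>k. taylor (D k a) = fps_hasse k (taylor a)}"
  have S_add: "a + b \<in> S" if "a \<in> S" "b \<in> S" for a b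
    using that by (simp add: S_def add_mem add mem taylor_add fps_hasse_add)
  have S_mult: "a * b \<in> S" if "a \<in> S" "b \<in> S" for a b
    using that by (simp add: S_def mult_mem leibniz mem taylor_sum taylor_mult fps_hasse_mult)
  have S_power: "w ^ n \<in> S" for n
    by (simp add: S_def power_mem uniformizer_mem power taylor_mult of_nat_mem taylor_of_nat
        taylor_power taylor_uniformizer fps_hasse_X_power)
  have S_scale: "\<iota> c * a \<in> S" if "a \<in> S" for c a
    using that by (simp add: S_def mult_mem const_mem scale mem taylor_mult taylor_const fps_hasse_const_mult)
  have S_eval1: "eval1 \<iota> q w \<in> S" for q
  proof (induction q)
    case 0
    show ?case using S_scale[OF S_power[of 0], of 0] by simp
  next
    case (pCons c q)
    show ?case using S_add[OF S_scale[OF S_power[of 0], of c] S_mult[OF S_power[of 1] pCons.IH]] by simp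
  qed
  have low: "\<exists>c\<in>R. D k (w ^ n * b) = w ^ (n - k) * c" if b: "b \<in> R" for n k b
  proof (cases "k \<le> n")
    case True
    have "D k (w ^ n * b) = (\<Sum>i\<le>k. of_nat (n choose i) * w ^ (n - i) * D (k - i) b)"
      by (simp only: leibniz[OF power_mem[OF uniformizer_mem] b] power)
    also have "\<dots> = (\<Sum>i\<le>k. w ^ (n - k) * (of_nat (n choose i) * w ^ (k - i) * D (k - i) b))"
    proof (intro sum.cong refl)
      fix i assume "i \<in> {..k}"
      hence "w ^ (n - i) = w ^ (n - k) * w ^ (k - i)"
        using True unfolding power_add[symmetric] by simp
      thus "of_nat (n choose i) * w ^ (n - i) * D (k - i) b =
          w ^ (n - k) * (of_nat (n choose i) * w ^ (k - i) * D (k - i) b)" by simp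
    qed
    finally show ?thesis
      by (intro bexI[of _ "\<Sum>i\<le>k. of_nat (n choose i) * w ^ (k - i) * D (k - i) b"])
        (simp_all add: sum_distrib_left sum_mem mult_mem of_nat_mem power_mem uniformizer_mem mem b)
  next
    case False
    thus ?thesis using mem[OF mult_mem[OF power_mem[OF uniformizer_mem] b]] by auto
  qed
  show ?thesis
  proof (rule fps_ext)
    fix m
    \<comment> \<open>Coefficient \<open>m\<close> of the \<open>k\<close>-th derivative reads
      coefficient \<open>m + k\<close>, which the truncation has to keep.\<close>
    define n where "n = Suc (m + k)"
    obtain q b where q: "b \<in> R" "a = eval1 \<iota> q w + w ^ n * b"
      using truncation[OF a] by blast
    have R: "eval1 \<iota> q w \<in> R" "w ^ n * b \<in> R"
      by (intro eval1_mem mult_mem power_mem uniformizer_mem q)+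
    obtain c where c: "c \<in> R" "D k (w ^ n * b) = w ^ (n - k) * c" using low[OF q(1)] by blast
    have "fps_nth (taylor (w ^ (n - k) * c)) m = 0"
      using taylor_low_eq_0_iff[of "w ^ (n - k) * c" "n - k"] c(1)
      by (auto simp: mult_mem power_mem uniformizer_mem n_def)
    moreover have "fps_nth (taylor (w ^ n * b)) (m + k) = 0"
      using taylor_low_eq_0_iff[of "w ^ n * b" n] R q(1) by (auto simp: n_def)
    moreover have "taylor (D k (eval1 \<iota> q w)) = fps_hasse k (taylor (eval1 \<iota> q w))"
      using S_eval1[of q] by (simp add: S_def)
    ultimately show "fps_nth (taylor (D k a)) m = fps_nth (fps_hasse k (taylor a)) m"
      unfolding q(2) add[OF R] taylor_add[OF mem[OF R(1)] mem[OF R(2)]] taylor_add[OF R] fps_hasse_add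
      by (simp add: c(2))
  qed
qed

text \<open>The derivatives are chosen through their expansions; injectivity of
  \<open>taylor\<close> then reduces each axiom to the same identity for power series.
  Extensionality fixes the values outside \<open>R\<close>, as the definite description
  demands.\<close>

lemma
  assumes a: "a \<in> R"
  shows hasse_deriv_mem: "hasse_deriv \<iota> R w k a \<in> R"
    and taylor_hasse_deriv: "taylor (hasse_deriv \<iota> R w k a) = fps_hasse k (taylor a)"
proof -
  define D where "D k = (\<lambda>a\<in>R. SOME b. b \<in> R \<and> taylor b = fps_hasse k (taylor a))" for k
  have "D k a \<in> R \<and> taylor (D k a) = fps_hasse k (taylor a)" if "a \<in> R" for k a
    using someI_ex[of "\<lambda>b. b \<in> R \<and> taylor b = fps_hasse k (taylor a)"] hasse_closed[OF that] that
    by (auto simp: D_def)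
  hence mem: "\<And>k a. a \<in> R \<Longrightarrow> D k a \<in> R" and taylor: "\<And>k a. a \<in> R \<Longrightarrow> taylor (D k a) = fps_hasse k (taylor a)"
    by blast+
  note closed = add_mem mult_mem const_mem mem sum_mem power_mem uniformizer_mem of_nat_mem
  note simps = taylor_add taylor_mult taylor_const taylor taylor_sum taylor_power taylor_uniformizer taylor_of_nat
  have "hasse_system \<iota> R w D"
    unfolding hasse_system_def
  proof (intro conjI allI ballI)
    show "D k \<in> R \<rightarrow>\<^sub>E R" for k
      using mem by (auto simp: D_def)
    show "D k (a + b) = D k a + D k b" if "a \<in> R" "b \<in> R" for k a b
      using that by (intro taylor_inject) (simp_all add: closed simps fps_hasse_add)
    show "D k (\<iota> c * a) = \<iota> c * D k a" if "a \<in> R" for k c a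
      using that by (intro taylor_inject) (simp_all add: closed simps fps_hasse_const_mult)
    show "D 0 a = a" if "a \<in> R" for a
      using that by (intro taylor_inject) (simp_all add: closed simps)
    show "D k (a * b) = (\<Sum>i\<le>k. D i a * D (k - i) b)" if "a \<in> R" "b \<in> R" for k a b
      using that by (intro taylor_inject) (simp_all add: closed simps fps_hasse_mult)
    show "D k (w ^ n) = of_nat (n choose k) * w ^ (n - k)" for k n
      by (intro taylor_inject) (simp_all add: closed simps fps_hasse_X_power)
  qed
  moreover have "D' = D" if D': "hasse_system \<iota> R w D'" for D'
  proof (intro ext)
    fix k a
    have ext: "D' k \<in> R \<rightarrow>\<^sub>E R" using D' unfolding hasse_system_def by blast
    show "D' k a = D k a"
    proof (cases "a \<in> R")
      case True
      thus ?thesis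
        using PiE_mem[OF ext True] mem[OF True] hasse_system_taylor[OF D' True] taylor[OF True]
        by (intro taylor_inject) auto
    next
      case False
      thus ?thesis using PiE_arb[OF ext False] by (simp add: D_def)
    qed
  qed
  ultimately have "hasse_deriv \<iota> R w = D"
    unfolding hasse_deriv_def by (rule the_equality)
  with mem[OF a] taylor[OF a]
  show "hasse_deriv \<iota> R w k a \<in> R" "taylor (hasse_deriv \<iota> R w k a) = fps_hasse k (taylor a)"
    by simp_all
qed

end

text \<open>Dividing \<open>w1^m - w2^m\<close> by \<open>w1 - w2\<close> gives the sum of all
  \<open>w1^i w2^j\<close> with \<open>i + j + 1 = m\<close>. So \<open>w2^j\<close> collects the
  coefficients of \<open>G\<close> from index \<open>j + 1\<close> on, shifted down.\<close>

lemma coeff_difference_quotient: "coeff (difference_quotient G) j = poly_shift (Suc j) G"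
proof -
  have shift: "poly_shift j G = pCons (coeff G j) (poly_shift (Suc j) G)" for j
    by (rule poly_eqI) (auto simp: coeff_poly_shift coeff_pCons split: nat.split)
  have zero: "poly_shift (Suc j) G = 0" if "j > degree G" for j
    by (rule poly_eqI) (use that in \<open>simp add: coeff_poly_shift coeff_eq_0\<close>)
  define B where "B = (\<Sum>j\<le>degree G. monom (poly_shift (Suc j) G) j)"
  have B: "coeff B j = poly_shift (Suc j) G" for j
    using zero[of j] by (auto simp: B_def coeff_sum coeff_monom if_distrib cong: if_cong)
  have "[:[:0, 1:], - 1:] * B = [:G:] - map_poly (\<lambda>c. [:c:]) G"
  proof (rule poly_eqI)
    fix j
    show "coeff ([:[:0, 1:], - 1:] * B) j = coeff ([:G:] - map_poly (\<lambda>c. [:c:]) G) j"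
    proof (cases j)
      case 0
      have "G = pCons (coeff G 0) (poly_shift (Suc 0) G)"
        using shift[of 0] by (simp add: poly_shift_id)
      hence "G - [:coeff G 0:] = pCons 0 (poly_shift (Suc 0) G)"
        by (metis add_diff_cancel_left' add_pCons add.right_neutral add_0)
      thus ?thesis by (simp add: 0 B coeff_map_poly)
    next
      case (Suc i)
      thus ?thesis by (simp add: B coeff_map_poly shift[of "Suc i"])
    qed
  qed
  hence "difference_quotient G = B"
    unfolding difference_quotient_def by (metis nonzero_mult_div_cancel_left pCons_eq_0_iff zero_neq_one neg_equal_0_iff_equal)
  thus ?thesis using B by simp
qed

text \<open>Substituting \<open>p = N - 1 - i\<close> turns the Hankel-type sum into a Cauchy
  product; \<open>g\<close> vanishes below \<open>N\<close> and so cuts it off at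
  \<open>p = j\<close>. The largest index of \<open>g\<close> that can occur is
  \<open>2N - 1\<close>, which explains the precision \<open>2N\<close> demanded of the polynomial
  \<open>G\<close>.\<close>

lemma sum_shift_convolution:
  fixes E :: "'a::comm_ring_1 fps"
  assumes g: "\<And>m. m < 2 * N \<Longrightarrow> g m = fps_nth (fps_X ^ N * E) m" and j: "j < N"
  shows "(\<Sum>i<N. g (i + Suc j) * e i) = fps_nth (E * Abs_fps (\<lambda>p. if p < N then e (N - Suc p) else 0)) j"
proof -
  have "(\<Sum>i<N. g (i + Suc j) * e i) = (\<Sum>p<N. g (N - Suc p + Suc j) * e (N - Suc p))"
    by (rule sum.nat_diff_reindex[symmetric])
  also have "\<dots> = (\<Sum>p<N. if p \<le> j then fps_nth E (j - p) * e (N - Suc p) else 0)"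
    using g j by (intro sum.cong) (auto simp: fps_X_power_mult_nth Suc_diff_Suc)
  also have "\<dots> = (\<Sum>p\<in>{0..j}. fps_nth E (j - p) * e (N - Suc p))"
    using j by (subst sum.inter_filter[symmetric]) (auto intro!: sum.cong)
  also have "\<dots> = fps_nth (Abs_fps (\<lambda>p. if p < N then e (N - Suc p) else 0) * E) j"
    unfolding fps_mult_nth using j by (intro sum.cong) (auto simp: mult.commute)
  finally show ?thesis by (simp only: mult.commute)
qed

section \<open>Ideals, dual functionals and bases modulo a function of given order\<close>

context uniformized_ring
begin

lemma mem_principal_power:
  "a \<in> principal R (w ^ n) \<longleftrightarrow> a \<in> R \<and> (\<forall>i<n. fps_nth (taylor a) i = 0)"
proof -
  have "a \<in> principal R (w ^ n) \<longleftrightarrow> a \<in> R \<and> (\<exists>b\<in>R. a = w ^ n * b)"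
    unfolding principal_def by (auto intro: mult_mem power_mem uniformizer_mem)
  thus ?thesis using taylor_low_eq_0_iff[of a n] by blast
qed

lemma ideal_pow_principal: "ideal_pow R (principal R w) n = principal R (w ^ n)"
proof (induction n)
  case 0
  show ?case by (auto simp: principal_def)
next
  case (Suc n)
  show ?case
  proof (intro equalityI subsetI)
    fix u assume "u \<in> ideal_pow R (principal R w) (Suc n)"
    then obtain k :: nat and a b where u: "u = (\<Sum>i<k. a i * b i)"
      "\<forall>i<k. a i \<in> principal R w \<and> b i \<in> principal R (w ^ n)"
      by (auto simp: Suc)
    have "\<exists>c\<in>R. a i * b i = w ^ Suc n * c" if "i < k" for i
    proof -
      from u(2) that obtain a' b' where "a' \<in> R" "b' \<in> R" "a i = w * a'" "b i = w ^ n * b'"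
        unfolding principal_def by blast
      thus ?thesis by (intro bexI[of _ "a' * b'"]) (auto intro: mult_mem)
    qed
    then obtain c where c: "\<And>i. i < k \<Longrightarrow> c i \<in> R" "\<And>i. i < k \<Longrightarrow> a i * b i = w ^ Suc n * c i"
      by metis
    have "u = w ^ Suc n * (\<Sum>i<k. c i)"
      unfolding u(1) sum_distrib_left using c(2) by (intro sum.cong) auto
    moreover have "(\<Sum>i<k. c i) \<in> R" using c(1) by (intro sum_mem) auto
    ultimately show "u \<in> principal R (w ^ Suc n)" unfolding principal_def by blast
  next
    fix u assume "u \<in> principal R (w ^ Suc n)"
    then obtain c where c: "c \<in> R" "u = w ^ Suc n * c" unfolding principal_def by blast
    have "w \<in> principal R w" unfolding principal_def using one_mem by force
    moreover have "w ^ n * c \<in> ideal_pow R (principal R w) n"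
      unfolding Suc unfolding principal_def using c(1) by (rule imageI)
    moreover have "u = (\<Sum>i<(1::nat). w * (w ^ n * c))" by (simp add: c(2) mult.assoc)
    ultimately show "u \<in> ideal_pow R (principal R w) (Suc n)"
      unfolding ideal_pow.simps mem_Collect_eq
      by (intro exI[of _ "1 :: nat"] exI[of _ "\<lambda>_. w"] exI[of _ "\<lambda>_. w ^ n * c"]) simp
  qed
qed

text \<open>The cofactor of \<open>w^N\<close> in \<open>\<phi>\<close> has expansion
  \<open>E\<close>; the constant term is nonzero, so the cofactor is a unit of
  \<open>R\<close>.\<close>

lemma principal_eq_power:
  assumes "\<phi> \<in> R" "taylor \<phi> = fps_X ^ N * E" "fps_nth E 0 \<noteq> 0"
  shows "principal R \<phi> = principal R (w ^ N)"
proof -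
  have "\<forall>i<N. fps_nth (taylor \<phi>) i = 0" using assms(2) by (simp add: fps_X_power_mult_nth)
  then obtain e where e: "e \<in> R" "\<phi> = w ^ N * e"
    unfolding taylor_low_eq_0_iff[OF assms(1)] by blast
  have "fps_X ^ N * taylor e = fps_X ^ N * E"
    using assms(2) unfolding e(2) using e(1)
    by (simp add: taylor_mult power_mem uniformizer_mem taylor_power taylor_uniformizer)
  hence "taylor e = E" by simp
  with assms(3) e(1) have inv: "inverse e \<in> R" "e \<noteq> 0" using inverse_mem by auto
  show ?thesis unfolding principal_def
  proof (intro equalityI subsetI; elim imageE)
    fix a b assume "a = \<phi> * b" "b \<in> R"
    thus "a \<in> (*) (w ^ N) ` R" using e by (intro image_eqI[of _ _ "e * b"]) (auto intro: mult_mem)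
  next
    fix a b assume "a = w ^ N * b" "b \<in> R"
    thus "a \<in> (*) \<phi> ` R" using e inv
      by (intro image_eqI[of _ _ "inverse e * b"]) (auto intro: mult_mem)
  qed
qed

lemma taylor_partial_sum:
  "fps_nth (taylor (\<Sum>j<n. \<iota> (c j) * w ^ j)) i = (if i < n then c i else 0)"
proof -
  have "(\<Sum>j<n. \<iota> (c j) * w ^ j) = eval1 \<iota> (\<Sum>j<n. monom (c j) j) w"
    by (simp add: eval1_sum eval1_monom)
  thus ?thesis
    by (simp add: taylor_eval1_uniformizer coeff_sum coeff_monom if_distrib cong: if_cong)
qed

lemma partial_sum_mem: "(\<Sum>j<n. \<iota> (c j) * w ^ j) \<in> R"
  by (intro sum_mem mult_mem const_mem power_mem uniformizer_mem)

definition linear_functional :: "('k \<Rightarrow> 'a) \<Rightarrow> bool" where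
  "linear_functional \<eta> \<longleftrightarrow> (\<forall>a\<in>R. \<forall>b\<in>R. \<eta> (a + b) = \<eta> a + \<eta> b) \<and> (\<forall>c. \<forall>a\<in>R. \<eta> (\<iota> c * a) = c * \<eta> a)"

lemma linear_functional_0: "linear_functional \<eta> \<Longrightarrow> \<eta> 0 = 0"
  unfolding linear_functional_def using one_mem by (metis hom_zero mult_zero_left)

lemma linear_functional_sum:
  assumes "linear_functional \<eta>" "\<And>i. i \<in> A \<Longrightarrow> u i \<in> R"
  shows "\<eta> (\<Sum>i\<in>A. \<iota> (c i) * u i) = (\<Sum>i\<in>A. c i * \<eta> (u i))"
  using assms(2)
proof (induction A rule: infinite_finite_induct)
  case (insert i A)
  have "(\<Sum>i\<in>A. \<iota> (c i) * u i) \<in> R" "\<iota> (c i) * u i \<in> R"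
    by (intro sum_mem mult_mem const_mem insert.prems; simp)+
  with insert assms(1) show ?case unfolding linear_functional_def by simp
qed (simp_all add: linear_functional_0[OF assms(1)])

lemma linear_functional_expand:
  assumes \<eta>: "linear_functional \<eta>" and zero: "\<forall>a\<in>principal R (w ^ N). \<eta> a = 0" and a: "a \<in> R"
  shows "\<eta> a = (\<Sum>i<N. fps_nth (taylor a) i * \<eta> (w ^ i))"
proof -
  let ?s = "\<Sum>i<N. \<iota> (fps_nth (taylor a) i) * w ^ i"
  have "a - ?s \<in> principal R (w ^ N)"
    unfolding mem_principal_power
    using a partial_sum_mem by (simp add: diff_mem taylor_diff taylor_partial_sum)
  moreover have "a = (a - ?s) + ?s" by simp
  moreover have "a - ?s \<in> R" "?s \<in> R" using a partial_sum_mem by (simp_all add: diff_mem)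
  ultimately have "\<eta> a = \<eta> ?s"
    using \<eta> zero unfolding linear_functional_def by (metis add_0)
  thus ?thesis using linear_functional_sum[OF \<eta>, of "{..<N}" "\<lambda>i. w ^ i"]
    by (simp add: power_mem uniformizer_mem)
qed

text \<open>The defining condition on \<open>\<eta>\<close> is a triangular system for the values \<open>\<eta>(w\<^sup>i)\<close>; read as an
  identity of power series, it says that \<open>\<Sum> \<eta>(w\<^sup>N\<^sup>-\<^sup>1\<^sup>-\<^sup>p) t\<^sup>p\<close> is inverse to \<open>\<phi>/t\<^sup>N\<close> modulo \<open>t\<^sup>N\<close>.\<close>

lemma dual_functional_iff:
  assumes \<phi>: "\<phi> \<in> R" "taylor \<phi> = fps_X ^ N * E" "fps_nth E 0 \<noteq> 0"
    and G: "\<forall>m<2 * N. coeff G m = fps_nth (taylor \<phi>) m"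
  shows "dual_functional \<iota> R w \<phi> G \<eta> \<longleftrightarrow> linear_functional \<eta> \<and>
    (\<forall>a\<in>principal R (w ^ N). \<eta> a = 0) \<and>
    (\<forall>j<N. fps_nth (E * Abs_fps (\<lambda>p. if p < N then \<eta> (w ^ (N - Suc p)) else 0)) j = fps_nth 1 j)"
proof -
  let ?B = "difference_quotient G"
  let ?s = "\<Sum>j\<le>degree ?B. \<iota> (\<eta> (eval1 \<iota> (coeff ?B j) w)) * w ^ j"
  have "?s - 1 \<in> principal R (w ^ N) \<longleftrightarrow>
      (\<forall>j<N. fps_nth (E * Abs_fps (\<lambda>p. if p < N then \<eta> (w ^ (N - Suc p)) else 0)) j = fps_nth 1 j)"
    if \<eta>: "linear_functional \<eta>" "\<forall>a\<in>principal R (w ^ N). \<eta> a = 0"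
  proof -
    have s: "fps_nth (taylor ?s) j = \<eta> (eval1 \<iota> (poly_shift (Suc j) G) w)" for j
    proof -
      have "fps_nth (taylor ?s) j = (if j < Suc (degree ?B) then \<eta> (eval1 \<iota> (coeff ?B j) w) else 0)"
        unfolding lessThan_Suc_atMost[symmetric] by (rule taylor_partial_sum)
      also have "\<dots> = \<eta> (eval1 \<iota> (coeff ?B j) w)"
        by (auto simp: coeff_eq_0 linear_functional_0[OF \<eta>(1)])
      finally show ?thesis by (simp add: coeff_difference_quotient)
    qed
    have "\<eta> (eval1 \<iota> (poly_shift (Suc j) G) w) =
        fps_nth (E * Abs_fps (\<lambda>p. if p < N then \<eta> (w ^ (N - Suc p)) else 0)) j" if "j < N" for j
    proof -
      have "\<eta> (eval1 \<iota> (poly_shift (Suc j) G) w) = (\<Sum>i<N. coeff G (i + Suc j) * \<eta> (w ^ i))"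
        unfolding linear_functional_expand[OF \<eta> eval1_mem[OF uniformizer_mem]]
        by (simp add: taylor_eval1_uniformizer coeff_poly_shift)
      also have "\<dots> = fps_nth (E * Abs_fps (\<lambda>p. if p < N then \<eta> (w ^ (N - Suc p)) else 0)) j"
        by (rule sum_shift_convolution) (use G \<phi>(2) that in auto)
      finally show ?thesis .
    qed
    moreover have "?s \<in> R" by (intro sum_mem mult_mem const_mem power_mem uniformizer_mem)
    ultimately show ?thesis
      unfolding mem_principal_power by (simp add: diff_mem one_mem taylor_diff s)
  qed
  thus ?thesis
    unfolding dual_functional_def linear_functional_def principal_eq_power[OF \<phi>] Let_def by blast
qed

text \<open>Dividing by \<open>E\<close> solves the triangular system. In invariant terms,
  coefficient \<open>N - 1\<close> of \<open>a/E\<close> is the residue of \<open>a dt\<close> over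
  \<open>t^N E\<close>.\<close>

lemma dual_functional_unique:
  assumes \<phi>: "\<phi> \<in> R" "taylor \<phi> = fps_X ^ N * E" "fps_nth E 0 \<noteq> 0"
    and G: "\<forall>m<2 * N. coeff G m = fps_nth (taylor \<phi>) m"
    and N: "N > 0" and \<eta>: "dual_functional \<iota> R w \<phi> G \<eta>" and a: "a \<in> R"
  shows "\<eta> a = fps_nth (inverse E * taylor a) (N - 1)"
proof -
  define e where "e = Abs_fps (\<lambda>p. if p < N then \<eta> (w ^ (N - Suc p)) else 0)"
  from \<eta> have lin: "linear_functional \<eta>" "\<forall>a\<in>principal R (w ^ N). \<eta> a = 0"
    and e: "\<And>j. j < N \<Longrightarrow> fps_nth (E * e) j = fps_nth 1 j"
    unfolding dual_functional_iff[OF \<phi> G] e_def by blast+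
  have "e = inverse E * (E * e)"
    using inverse_mult_eq_1[OF \<phi>(3)] by (simp add: mult.assoc[symmetric])
  hence e_nth: "fps_nth e p = fps_nth (inverse E) p" if "p < N" for p
  proof -
    have "fps_nth e p = fps_nth (inverse E * (E * e)) p"
      by (rule arg_cong[of _ _ "\<lambda>s. fps_nth s p"]) fact
    also have "\<dots> = fps_nth (inverse E * 1) p"
      unfolding fps_mult_nth[of "inverse E"] using e that by (intro sum.cong) auto
    finally show ?thesis by simp
  qed
  have "\<eta> a = (\<Sum>i<N. fps_nth (taylor a) i * \<eta> (w ^ i))"
    by (rule linear_functional_expand[OF lin a])
  also have "\<dots> = (\<Sum>i<N. fps_nth (taylor a) i * fps_nth (inverse E) (N - 1 - i))"
  proof (intro sum.cong refl)
    fix i assume "i \<in> {..<N}"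
    thus "fps_nth (taylor a) i * \<eta> (w ^ i) = fps_nth (taylor a) i * fps_nth (inverse E) (N - 1 - i)"
      using e_nth[of "N - 1 - i"] by (simp add: e_def)
  qed
  also have "\<dots> = fps_nth (taylor a * inverse E) (N - 1)"
    unfolding fps_mult_nth using N by (intro sum.cong) auto
  finally show ?thesis by (simp add: mult.commute)
qed

lemma dual_functional_exists:
  assumes \<phi>: "\<phi> \<in> R" "taylor \<phi> = fps_X ^ N * E" "fps_nth E 0 \<noteq> 0"
    and G: "\<forall>m<2 * N. coeff G m = fps_nth (taylor \<phi>) m" and N: "N > 0"
  shows "dual_functional \<iota> R w \<phi> G (\<lambda>a. fps_nth (inverse E * taylor a) (N - 1))"
  unfolding dual_functional_iff[OF \<phi> G]
proof (intro conjI ballI allI impI)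
  show "linear_functional (\<lambda>a. fps_nth (inverse E * taylor a) (N - 1))"
    unfolding linear_functional_def
    by (simp add: taylor_add taylor_mult taylor_const const_mem distrib_left mult.left_commute[of "inverse E"])
next
  fix a assume "a \<in> principal R (w ^ N)"
  thus "fps_nth (inverse E * taylor a) (N - 1) = 0"
    unfolding mem_principal_power fps_mult_nth using N by (intro sum.neutral) auto
next
  fix j assume j: "j < N"
  have nth: "fps_nth (inverse E * taylor (w ^ (N - Suc p))) (N - 1) = fps_nth (inverse E) p" if "p < N" for p
    using that by (simp add: taylor_power uniformizer_mem taylor_uniformizer fps_X_power_mult_right_nth)
  define e where "e = Abs_fps (\<lambda>p. if p < N then fps_nth (inverse E * taylor (w ^ (N - Suc p))) (N - 1) else 0)"
  have e: "fps_nth e p = fps_nth (inverse E) p" if "p < N" for p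
    using nth[OF that] that by (simp add: e_def)
  have "fps_nth (E * e) j = fps_nth (E * inverse E) j"
    unfolding fps_mult_nth[of E] using j e by (intro sum.cong) auto
  thus "fps_nth (E * e) j = fps_nth 1 j"
    using inverse_mult_eq_1'[OF \<phi>(3)] by simp
qed

lemma taylor_combination:
  assumes "\<And>j. j < m \<Longrightarrow> u j \<in> R"
  shows "fps_nth (taylor (\<Sum>j<m. \<iota> (c j) * u j)) i = (\<Sum>j<m. fps_nth (taylor (u j)) i * c j)"
  using assms by (subst taylor_sum)
    (auto simp: mult_mem const_mem taylor_mult taylor_const fps_sum_nth mult.commute intro!: sum.cong)

lemma combination_mem:
  assumes "\<And>j. j < m \<Longrightarrow> u j \<in> R"
  shows "(\<Sum>j<m. \<iota> (c j) * u j) \<in> R"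
  using assms by (intro sum_mem mult_mem const_mem) auto

text \<open>Congruence modulo \<open>(w^N)\<close> turns the basis property into a linear system of
  \<open>N\<close> equations in \<open>m\<close> unknowns. Unique solvability for the zero element
  gives a trivial kernel, solvability for the powers of \<open>w\<close> a right inverse; together
  they force a square invertible matrix.\<close>

lemma quotient_basis_matrix:
  assumes basis: "quotient_basis \<iota> R \<phi> es" and \<phi>: "principal R \<phi> = principal R (w ^ N)"
  shows "length es = N"
    and "det (mat N N (\<lambda>(i, j). fps_nth (taylor (es ! j)) i)) \<noteq> 0"
proof -
  define m where "m = length es"
  define p where "p i j = fps_nth (taylor (es ! j)) i" for i j
  have es: "es ! j \<in> R" if "j < m" for j
    using basis that unfolding quotient_basis_def m_def by auto
  have cong: "a - (\<Sum>j<m. \<iota> (c j) * es ! j) \<in> principal R \<phi> \<longleftrightarrow>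
      (\<forall>i<N. fps_nth (taylor a) i = (\<Sum>j<m. p i j * c j))" if "a \<in> R" for a c
    unfolding \<phi> mem_principal_power p_def
    using that es by (simp add: diff_mem combination_mem taylor_diff taylor_combination)
  have ex1: "\<exists>!cs. length cs = m \<and> (\<forall>i<N. fps_nth (taylor a) i = (\<Sum>j<m. p i j * cs ! j))"
    if a: "a \<in> R" for a
    using basis a unfolding quotient_basis_def m_def[symmetric] cong[OF a, symmetric] by blast
  have inj: "c j = 0" if c: "\<forall>i<N. (\<Sum>j<m. p i j * c j) = 0" and j: "j < m" for c j
  proof -
    let ?cs = "map c [0..<m]"
    have "(\<Sum>j<m. p i j * ?cs ! j) = (\<Sum>j<m. p i j * c j)" for i by (intro sum.cong) auto
    hence "length ?cs = m \<and> (\<forall>i<N. fps_nth (taylor 0) i = (\<Sum>j<m. p i j * ?cs ! j))"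
      using c by simp
    moreover have "length (replicate m 0) = m \<and>
        (\<forall>i<N. fps_nth (taylor 0) i = (\<Sum>j<m. p i j * replicate m 0 ! j))" by simp
    ultimately have "?cs = replicate m 0" using ex1[OF zero_mem] by blast
    hence "?cs ! j = 0" using j by simp
    thus ?thesis using j by simp
  qed
  have surj: "\<exists>c. \<forall>i<N. (\<Sum>j<m. p i j * c j) = (if i = k then 1 else 0)" for k
  proof -
    obtain cs where "\<forall>i<N. fps_nth (taylor (w ^ k)) i = (\<Sum>j<m. p i j * cs ! j)"
      using ex1[OF power_mem[OF uniformizer_mem], of k] by blast
    hence "\<forall>i<N. (\<Sum>j<m. p i j * cs ! j) = (if i = k then 1 else 0)"
      by (auto simp: taylor_power uniformizer_mem taylor_uniformizer fps_X_power_nth)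
    thus ?thesis by blast
  qed
  have no_kernel: "v = 0\<^sub>v m" if v: "v \<in> carrier_vec m" "\<forall>i<N. (\<Sum>j<m. p i j * v $ j) = 0" for v
    using inj[of "\<lambda>j. v $ j"] v by (intro eq_vecI) auto
  have "m \<le> N"
  proof (rule ccontr)
    assume "\<not> m \<le> N"
    \<comment> \<open>Zero rows make the matrix square; its determinant vanishes and yields a
      nonzero kernel vector.\<close>
    define A where "A = mat m m (\<lambda>(i, j). if i < N then p i j else 0)"
    have A: "A \<in> carrier_mat m m" by (simp add: A_def)
    have "det A = 0"
      using \<open>\<not> m \<le> N\<close> by (subst laplace_expansion_row[OF A, of N]) (auto simp: A_def)
    then obtain v where v: "v \<in> carrier_vec m" "v \<noteq> 0\<^sub>v m" "A *\<^sub>v v = 0\<^sub>v m"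
      unfolding det_0_iff_vec_prod_zero_field[OF A] by blast
    have "(\<Sum>j<m. p i j * v $ j) = 0" if "i < N" for i
    proof -
      have "(A *\<^sub>v v) $ i = (\<Sum>j<m. p i j * v $ j)"
        using that \<open>\<not> m \<le> N\<close> v(1) by (simp add: A_def scalar_prod_def atLeast0LessThan)
      thus ?thesis using v(3) that \<open>\<not> m \<le> N\<close> by simp
    qed
    with no_kernel v show False by blast
  qed
  moreover have "N \<le> m"
  proof (rule ccontr)
    assume "\<not> N \<le> m"
    from surj obtain q where q: "\<And>k i. i < N \<Longrightarrow> (\<Sum>j<m. p i j * q k j) = (if i = k then 1 else 0)"
      by metis
    \<comment> \<open>Zero columns make the matrix square; it would have a right inverse although
      its determinant is zero.\<close>
    define A where "A = mat N N (\<lambda>(i, j). if j < m then p i j else 0)"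
    define Q where "Q = mat N N (\<lambda>(j, k). q k j)"
    have A: "A \<in> carrier_mat N N" and Q: "Q \<in> carrier_mat N N" by (simp_all add: A_def Q_def)
    have "A * Q = 1\<^sub>m N"
    proof (rule eq_matI)
      fix i k assume "i < dim_row (1\<^sub>m N)" "k < dim_col (1\<^sub>m N)"
      hence ik: "i < N" "k < N" by simp_all
      hence "(A * Q) $$ (i, k) = (\<Sum>j<N. if j < m then p i j * q k j else 0)"
        by (auto simp: A_def Q_def scalar_prod_def atLeast0LessThan intro!: sum.cong)
      also have "\<dots> = (\<Sum>j<m. p i j * q k j)"
        using \<open>\<not> N \<le> m\<close> by (intro sum.mono_neutral_cong_right) auto
      finally show "(A * Q) $$ (i, k) = 1\<^sub>m N $$ (i, k)" using ik q by simp
    qed (simp_all add: A_def Q_def)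
    hence "det A * det Q = 1" using det_mult[OF A Q] by simp
    moreover have "det A = 0"
      using \<open>\<not> N \<le> m\<close> by (subst laplace_expansion_column[OF A, of m]) (auto simp: A_def)
    ultimately show False by simp
  qed
  ultimately have mN: "m = N" by simp
  thus "length es = N" by (simp add: m_def)
  let ?P = "mat N N (\<lambda>(i, j). fps_nth (taylor (es ! j)) i)"
  have P: "?P \<in> carrier_mat N N" by simp
  show "det ?P \<noteq> 0"
  proof
    assume "det ?P = 0"
    then obtain v where v: "v \<in> carrier_vec N" "v \<noteq> 0\<^sub>v N" "?P *\<^sub>v v = 0\<^sub>v N"
      unfolding det_0_iff_vec_prod_zero_field[OF P] by blast
    have "(\<Sum>j<N. p i j * v $ j) = 0" if "i < N" for i
    proof -
      have "(?P *\<^sub>v v) $ i = (\<Sum>j<N. p i j * v $ j)"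
        using that v(1) by (simp add: p_def scalar_prod_def atLeast0LessThan)
      thus ?thesis using v(3) that by simp
    qed
    with no_kernel v mN show False by blast
  qed
qed

lemma quotient_basis_powers:
  assumes "principal R \<phi> = principal R (w ^ N)"
  shows "quotient_basis \<iota> R \<phi> (map (\<lambda>i. w ^ i) [0..<N])"
  unfolding quotient_basis_def
proof (intro conjI ballI)
  show "set (map (\<lambda>i. w ^ i) [0..<N]) \<subseteq> R" by (auto intro: power_mem uniformizer_mem)
  fix a assume a: "a \<in> R"
  have "a - (\<Sum>i<N. \<iota> (cs ! i) * map (\<lambda>i. w ^ i) [0..<N] ! i) \<in> principal R \<phi> \<longleftrightarrow>
      (\<forall>i<N. fps_nth (taylor a) i = cs ! i)" for cs
  proof -
    have "(\<Sum>i<N. \<iota> (cs ! i) * map (\<lambda>i. w ^ i) [0..<N] ! i) = (\<Sum>i<N. \<iota> (cs ! i) * w ^ i)"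
      by (intro sum.cong) auto
    thus ?thesis
      unfolding assms mem_principal_power
      using a by (simp add: diff_mem partial_sum_mem taylor_diff taylor_partial_sum)
  qed
  moreover have "\<exists>!cs. length cs = N \<and> (\<forall>i<N. fps_nth (taylor a) i = cs ! i)"
    by (rule ex1I[of _ "map (\<lambda>i. fps_nth (taylor a) i) [0..<N]"]) (auto intro: nth_equalityI)
  ultimately show "\<exists>!cs. length cs = length (map (\<lambda>i. w ^ i) [0..<N]) \<and>
      a - (\<Sum>i<length (map (\<lambda>i. w ^ i) [0..<N]). \<iota> (cs ! i) * map (\<lambda>i. w ^ i) [0..<N] ! i)
        \<in> principal R \<phi>" by simp
qed

text \<open>The definite description needs a witness and independence of all choices. The witness
  takes exponent \<open>N\<close>, the truncated expansion of \<open>\<phi>\<close> and the powers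
  of \<open>w\<close>; for any other choice the functional is the same residue on \<open>R\<close>,
  and the basis changes the Gram matrix by a congruence. The free square \<open>b ^ 2\<close> allows
  the unit to be normalized later.\<close>

lemma euler_index_odd_order:
  assumes two: "(2 :: 'a) \<noteq> 0" and \<phi>: "\<phi> \<in> R" "taylor \<phi> = fps_X ^ N * E" "fps_nth E 0 \<noteq> 0"
    and N: "N = 2 * K + 1" and b: "b \<noteq> 0"
  shows "euler_index \<iota> R (principal R w) w \<phi> =
    (\<Sum>_<K. gw_hyperbolic) + gw_unit (inverse (fps_nth E 0) * b ^ 2)"
proof -
  let ?v = "inverse E"
  let ?c = "(\<Sum>_<K. gw_hyperbolic) + gw_unit (fps_nth ?v 0 * b ^ 2)"
  have v: "fps_nth ?v 0 \<noteq> 0" using \<phi>(3) by simp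
  note nondeg = nondeg_sym_residue_gram[OF two v, of K, folded N]
    and gw = gw_form_residue_gram[OF two v b, of K, folded N]
  note pr = principal_eq_power[OF \<phi>]
  have pos: "N > 0" by (simp add: N)
  have "euler_index \<iota> R (principal R w) w \<phi> = ?c"
    unfolding euler_index_def ideal_pow_principal
  proof (rule the_equality)
    define G where "G = (\<Sum>i<2 * N. monom (fps_nth (taylor \<phi>) i) i)"
    define \<eta> where "\<eta> a = fps_nth (inverse E * taylor a) (N - 1)" for a
    define es where "es = map (\<lambda>i. w ^ i) [0..<N]"
    have G: "\<forall>m<2 * N. coeff G m = fps_nth (taylor \<phi>) m"
      by (auto simp: G_def coeff_sum coeff_monom if_distrib cong: if_cong)
    have "principal R (w ^ N) \<subseteq> principal R \<phi>" by (simp add: pr)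
    moreover have "eval1 \<iota> G w - \<phi> \<in> principal R (w ^ (2 * N))"
      unfolding mem_principal_power using G \<phi>(1)
      by (simp add: diff_mem eval1_mem uniformizer_mem taylor_diff taylor_eval1_uniformizer)
    moreover have "dual_functional \<iota> R w \<phi> G \<eta>"
      unfolding \<eta>_def by (rule dual_functional_exists[OF \<phi> G pos])
    moreover have "quotient_basis \<iota> R \<phi> es"
      unfolding es_def by (rule quotient_basis_powers[OF pr])
    moreover have "?c = gw_form (mat (length es) (length es) (\<lambda>(i, j). \<eta> (es ! i * es ! j)))"
    proof -
      have "mat (length es) (length es) (\<lambda>(i, j). \<eta> (es ! i * es ! j)) =
          residue_gram N ?v (\<lambda>i. fps_X ^ i)"
        by (rule eq_matI) (auto simp: es_def residue_gram_def \<eta>_def taylor_mult power_mem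
            uniformizer_mem taylor_power taylor_uniformizer mult.assoc)
      thus ?thesis by (simp add: gw)
    qed
    ultimately show "\<exists>n G \<eta> es. principal R (w ^ n) \<subseteq> principal R \<phi> \<and>
        eval1 \<iota> G w - \<phi> \<in> principal R (w ^ (2 * n)) \<and> dual_functional \<iota> R w \<phi> G \<eta> \<and>
        quotient_basis \<iota> R \<phi> es \<and>
        ?c = gw_form (mat (length es) (length es) (\<lambda>(i, j). \<eta> (es ! i * es ! j)))" by blast
  next
    fix c assume "\<exists>n G \<eta> es. principal R (w ^ n) \<subseteq> principal R \<phi> \<and>
        eval1 \<iota> G w - \<phi> \<in> principal R (w ^ (2 * n)) \<and> dual_functional \<iota> R w \<phi> G \<eta> \<and>
        quotient_basis \<iota> R \<phi> es \<and>
        c = gw_form (mat (length es) (length es) (\<lambda>(i, j). \<eta> (es ! i * es ! j)))"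
    then obtain n G \<eta> es where n: "principal R (w ^ n) \<subseteq> principal R \<phi>"
      and G': "eval1 \<iota> G w - \<phi> \<in> principal R (w ^ (2 * n))" and \<eta>: "dual_functional \<iota> R w \<phi> G \<eta>"
      and es: "quotient_basis \<iota> R \<phi> es"
      and c: "c = gw_form (mat (length es) (length es) (\<lambda>(i, j). \<eta> (es ! i * es ! j)))" by blast
    \<comment> \<open>\<open>w^n\<close> lies in \<open>(w^N)\<close> only if
      \<open>N \<le> n\<close>, so the congruence modulo \<open>w^(2n)\<close> fixes the
      coefficients of \<open>G\<close> below \<open>2N\<close>.\<close>
    have "w ^ n \<in> principal R (w ^ n)"
      unfolding mem_principal_power
      by (auto simp: power_mem uniformizer_mem taylor_power taylor_uniformizer fps_X_power_nth)
    with n have "w ^ n \<in> principal R (w ^ N)" by (auto simp: pr)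
    hence "N \<le> n"
      unfolding mem_principal_power
      by (auto simp: taylor_power uniformizer_mem taylor_uniformizer fps_X_power_nth not_less[symmetric])
    hence G: "\<forall>m<2 * N. coeff G m = fps_nth (taylor \<phi>) m"
      using G' unfolding mem_principal_power
      by (simp add: \<phi>(1) eval1_mem uniformizer_mem taylor_diff taylor_eval1_uniformizer)
    have len: "length es = N" and det: "det (mat N N (\<lambda>(i, j). fps_nth (taylor (es ! j)) i)) \<noteq> 0"
      using quotient_basis_matrix[OF es pr] by blast+
    have esR: "es ! i \<in> R" if "i < N" for i
      using es that len unfolding quotient_basis_def by auto
    have "mat N N (\<lambda>(i, j). \<eta> (es ! i * es ! j)) = residue_gram N ?v (\<lambda>i. taylor (es ! i))"
      unfolding residue_gram_def
      by (rule eq_matI)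
        (auto simp: dual_functional_unique[OF \<phi> G pos \<eta>] mult_mem esR taylor_mult mult.assoc)
    also have "isometric (residue_gram N ?v (\<lambda>i. fps_X ^ i)) \<dots>"
      by (rule isometricI[OF nondeg _ det residue_gram_congruence[OF pos]])
        (simp add: residue_gram_def)
    finally show "c = ?c"
      unfolding c len gw[symmetric] by (rule gw_form_isometric[symmetric])
  qed
  thus ?thesis by simp
qed

end

section \<open>The hyperelliptic curve at infinity\<close>

context field_hom
begin

lemma eval2_0 [simp]: "eval2 hom 0 u v = 0"
  by (simp add: eval2_def)

lemma eval2_pCons [simp]: "eval2 hom (pCons p P) u v = eval1 hom p u + v * eval2 hom P u v"
  by (simp add: eval2_def Polynomial.map_poly_pCons)

lemma eval2_1 [simp]: "eval2 hom 1 u v = 1"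
  by (simp add: one_pCons)

lemma eval2_add: "eval2 hom (P + Q) u v = eval2 hom P u v + eval2 hom Q u v"
  by (induction P Q rule: poly_induct2) (simp_all add: eval1_add algebra_simps)

lemma eval2_smult: "eval2 hom (smult p P) u v = eval1 hom p u * eval2 hom P u v"
  by (induction P) (simp_all add: eval1_mult algebra_simps)

lemma eval2_mult: "eval2 hom (P * Q) u v = eval2 hom P u v * eval2 hom Q u v"
  by (induction P) (simp_all add: eval2_add eval2_smult algebra_simps)

lemma eval1_sum_coeff:
  assumes "degree p \<le> n"
  shows "eval1 hom p u = (\<Sum>i\<le>n. hom (coeff p i) * u ^ i)"
proof -
  have "p = (\<Sum>i\<le>n. monom (coeff p i) i)"
    using poly_as_sum_of_monoms'[OF assms] by simp
  hence "eval1 hom p u = eval1 hom (\<Sum>i\<le>n. monom (coeff p i) i) u" by simp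
  thus ?thesis by (simp add: eval1_sum eval1_monom)
qed

end

section \<open>Closure of the local ring under Hasse derivatives\<close>

context uniformized_ring
begin

definition taylor_image :: "'a fps set" where
  "taylor_image = taylor ` R"

lemma taylor_image_add: "s \<in> taylor_image \<Longrightarrow> t \<in> taylor_image \<Longrightarrow> s + t \<in> taylor_image"
  unfolding taylor_image_def by (elim imageE) (simp only: taylor_add[symmetric] imageI add_mem)

lemma taylor_image_diff: "s \<in> taylor_image \<Longrightarrow> t \<in> taylor_image \<Longrightarrow> s - t \<in> taylor_image"
  unfolding taylor_image_def by (elim imageE) (simp only: taylor_diff[symmetric] imageI diff_mem)

lemma taylor_image_mult: "s \<in> taylor_image \<Longrightarrow> t \<in> taylor_image \<Longrightarrow> s * t \<in> taylor_image"
  unfolding taylor_image_def by (elim imageE) (simp only: taylor_mult[symmetric] imageI mult_mem)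

lemma taylor_image_0: "0 \<in> taylor_image"
  unfolding taylor_image_def using taylor_0 zero_mem by force

lemma taylor_image_sum: "(\<And>i. i \<in> A \<Longrightarrow> s i \<in> taylor_image) \<Longrightarrow> sum s A \<in> taylor_image"
  by (induction A rule: infinite_finite_induct) (auto intro: taylor_image_add taylor_image_0)

lemma taylor_in_image: "a \<in> R \<Longrightarrow> taylor a \<in> taylor_image"
  unfolding taylor_image_def by simp

text \<open>A property stable under the operations that generate the local ring at infinity, so that
  \<open>hasse_closed\<close> there reduces to the two coordinates.\<close>

definition smooth :: "'k \<Rightarrow> bool" where
  "smooth a \<longleftrightarrow> a \<in> R \<and> (\<forall>k. fps_hasse k (taylor a) \<in> taylor_image)"

lemma fps_hasse_eval1_uniformizer: "fps_hasse k (fps_of_poly q) \<in> taylor_image"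
proof -
  have "fps_hasse k (fps_of_poly q) = fps_of_poly (\<Sum>n\<le>degree q. monom (of_nat ((n + k) choose k) * coeff q (n + k)) n)"
    by (rule fps_ext) (auto simp: coeff_sum coeff_monom if_distrib coeff_eq_0 cong: if_cong)
  thus ?thesis
    unfolding taylor_eval1_uniformizer[symmetric]
    by (simp only: taylor_in_image eval1_mem uniformizer_mem)
qed

lemma smooth_eval1_uniformizer: "smooth (eval1 \<iota> q w)"
  unfolding smooth_def taylor_eval1_uniformizer
  by (simp add: fps_hasse_eval1_uniformizer eval1_mem uniformizer_mem)

lemma smooth_const: "smooth (\<iota> c)" and smooth_uniformizer: "smooth w"
  using smooth_eval1_uniformizer[of "[:c:]"] smooth_eval1_uniformizer[of "[:0, 1:]"] by simp_all

lemma smooth_add: "smooth a \<Longrightarrow> smooth b \<Longrightarrow> smooth (a + b)"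
  unfolding smooth_def by (simp add: add_mem taylor_add fps_hasse_add taylor_image_add)

lemma smooth_mult: "smooth a \<Longrightarrow> smooth b \<Longrightarrow> smooth (a * b)"
  unfolding smooth_def
  by (simp add: mult_mem taylor_mult fps_hasse_mult taylor_image_sum taylor_image_mult)

lemma smooth_eval1: "smooth a \<Longrightarrow> smooth (eval1 \<iota> p a)"
  by (induction p) (use smooth_const[of 0] in \<open>auto intro: smooth_add smooth_mult smooth_const\<close>)

lemma smooth_eval2: "smooth a \<Longrightarrow> smooth b \<Longrightarrow> smooth (eval2 \<iota> P a b)"
  by (induction P) (use smooth_const[of 0] in \<open>auto intro: smooth_add smooth_mult smooth_eval1\<close>)

text \<open>In the Leibniz rule for \<open>a\<close> times its inverse, the \<open>k\<close>-th
  derivative of the inverse has the unit factor \<open>a\<close>. All other terms contain lower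
  derivatives of the inverse, so induction on \<open>k\<close> applies.\<close>

lemma smooth_inverse:
  assumes a: "smooth a" "fps_nth (taylor a) 0 \<noteq> 0"
  shows "smooth (inverse a)"
proof -
  have aR: "a \<in> R" and inv: "inverse a \<in> R" using a inverse_mem by (auto simp: smooth_def)
  have one: "taylor a * taylor (inverse a) = 1"
    using taylor_mult[OF aR inv] taylor_nth_0_neq_0[OF a(2)] by simp
  have "fps_hasse k (taylor (inverse a)) \<in> taylor_image" for k
  proof (induction k rule: less_induct)
    case (less k)
    let ?s = "\<Sum>i<k. fps_hasse (Suc i) (taylor a) * fps_hasse (k - Suc i) (taylor (inverse a))"
    have s: "?s \<in> taylor_image"
      by (intro taylor_image_sum taylor_image_mult less.IH) (use a in \<open>auto simp: smooth_def\<close>)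
    have "fps_hasse k 1 = taylor a * fps_hasse k (taylor (inverse a)) + ?s"
      unfolding one[symmetric] fps_hasse_mult by (subst sum.atMost_shift) simp
    hence "taylor (inverse a) * (fps_hasse k 1 - ?s) =
        (taylor a * taylor (inverse a)) * fps_hasse k (taylor (inverse a))"
      by (simp add: algebra_simps)
    hence "fps_hasse k (taylor (inverse a)) = taylor (inverse a) * (fps_hasse k 1 - ?s)"
      by (simp add: one)
    moreover have "fps_hasse k 1 \<in> taylor_image"
      using fps_hasse_eval1_uniformizer[of k 1] by simp
    ultimately show ?case
      using s by (simp add: taylor_image_mult taylor_image_diff taylor_in_image inv)
  qed
  thus ?thesis using inv by (simp add: smooth_def)
qed

text \<open>Newton's argument: if \<open>q(a)\<close> has Hasse derivatives in \<open>R\<close> and \<open>q'(a)\<close> is a unit, then the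
  Leibniz rule for \<open>q(a)\<close> can be solved for the derivatives of \<open>a\<close>.\<close>

lemma fps_hasse_eval1_linearized:
  assumes a: "a \<in> R" and k: "k > 0" and low: "\<And>i. i < k \<Longrightarrow> fps_hasse i (taylor a) \<in> taylor_image"
  shows "(\<forall>j<k. fps_hasse j (taylor (eval1 \<iota> q a)) \<in> taylor_image) \<and>
    fps_hasse k (taylor (eval1 \<iota> q a)) - taylor (eval1 \<iota> (pderiv q) a) * fps_hasse k (taylor a) \<in> taylor_image"
proof (induction q)
  case 0
  have "fps_hasse j 0 \<in> taylor_image" for j
    using fps_hasse_eval1_uniformizer[of j 0] by simp
  thus ?case by simp
next
  case (pCons c p)
  let ?A = "taylor a" and ?P = "taylor (eval1 \<iota> p a)"
  have P: "fps_hasse j ?P \<in> taylor_image" if "j < k" for j using pCons.IH that by blast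
  have const: "fps_hasse j (fps_const c) \<in> taylor_image" for j
    using fps_hasse_eval1_uniformizer[of j "[:c:]"] by (simp add: fps_of_poly_const)
  have expand: "taylor (eval1 \<iota> (pCons c p) a) = fps_const c + ?A * ?P"
    using a by (simp add: taylor_add taylor_mult taylor_const const_mem mult_mem eval1_mem)
  have "fps_hasse j (taylor (eval1 \<iota> (pCons c p) a)) \<in> taylor_image" if "j < k" for j
    unfolding expand fps_hasse_add fps_hasse_mult
    by (intro taylor_image_add const taylor_image_sum taylor_image_mult low P) (use that in auto)
  moreover have "fps_hasse k (taylor (eval1 \<iota> (pCons c p) a)) -
      taylor (eval1 \<iota> (pderiv (pCons c p)) a) * fps_hasse k ?A \<in> taylor_image"
  proof -
    obtain k' where k': "k = Suc k'" using k by (cases k) auto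
    let ?s = "\<Sum>i<k'. fps_hasse (Suc i) ?A * fps_hasse (k' - i) ?P"
    have "fps_hasse k (?A * ?P) = ?A * fps_hasse k ?P + (?s + fps_hasse k ?A * ?P)"
      unfolding fps_hasse_mult k' by (subst sum.atMost_Suc_shift) (simp add: lessThan_Suc_atMost[symmetric])
    moreover have "taylor (eval1 \<iota> (pderiv (pCons c p)) a) = ?P + ?A * taylor (eval1 \<iota> (pderiv p) a)"
      using a by (simp add: pderiv_pCons eval1_add taylor_add taylor_mult mult_mem eval1_mem)
    ultimately have "fps_hasse k (taylor (eval1 \<iota> (pCons c p) a)) -
        taylor (eval1 \<iota> (pderiv (pCons c p)) a) * fps_hasse k ?A =
        fps_hasse k (fps_const c) +
        ?A * (fps_hasse k ?P - taylor (eval1 \<iota> (pderiv p) a) * fps_hasse k ?A) + ?s"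
      unfolding expand fps_hasse_add by (simp add: algebra_simps)
    also have "\<dots> \<in> taylor_image"
      using pCons.IH a
      by (intro taylor_image_add const taylor_image_mult taylor_in_image taylor_image_sum low P)
        (auto simp: k')
    finally show ?thesis .
  qed
  ultimately show ?case by blast
qed

lemma smooth_root:
  assumes a: "a \<in> R" and q: "smooth (eval1 \<iota> q a)"
    and unit: "fps_nth (taylor (eval1 \<iota> (pderiv q) a)) 0 \<noteq> 0"
  shows "smooth a"
proof -
  let ?d = "eval1 \<iota> (pderiv q) a"
  have d: "?d \<in> R" by (rule eval1_mem[OF a])
  have inv: "inverse ?d \<in> R" by (rule inverse_mem[OF d unit])
  have one: "taylor (inverse ?d) * taylor ?d = 1"
    using taylor_mult[OF inv d] taylor_nth_0_neq_0[OF unit] by simp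
  have "fps_hasse k (taylor a) \<in> taylor_image" for k
  proof (induction k rule: less_induct)
    case (less k)
    show ?case
    proof (cases "k = 0")
      case True
      thus ?thesis by (simp add: taylor_in_image a)
    next
      case False
      let ?r = "fps_hasse k (taylor (eval1 \<iota> q a)) - taylor ?d * fps_hasse k (taylor a)"
      have "?r \<in> taylor_image"
        using fps_hasse_eval1_linearized[OF a _ less.IH, of k q] False by simp
      moreover have "fps_hasse k (taylor (eval1 \<iota> q a)) \<in> taylor_image"
        using q by (simp add: smooth_def)
      ultimately have "taylor (inverse ?d) * (fps_hasse k (taylor (eval1 \<iota> q a)) - ?r) \<in> taylor_image"
        by (simp only: taylor_image_mult taylor_image_diff taylor_in_image[OF inv])
      thus ?thesis by (simp add: mult.assoc[symmetric] one)
    qed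
  qed
  with a show ?thesis by (simp add: smooth_def)
qed

end

section \<open>The local ring at infinity and its coordinates\<close>

locale hyperelliptic_infinity =
  fixes \<iota> :: "'a::field \<Rightarrow> 'k::field" and x y :: 'k and f :: "'a poly" and g :: nat
  assumes curve: "hyperelliptic_curve \<iota> x y f g"

sublocale hyperelliptic_infinity \<subseteq> field_hom \<iota>
  using curve by (simp add: hyperelliptic_curve_def)

context hyperelliptic_infinity
begin

abbreviation "z \<equiv> z_coord x"
abbreviation "w \<equiv> w_coord x y g"
abbreviation "h \<equiv> h_poly g f"
abbreviation "R \<equiv> local_ring_inf \<iota> x y g"

text \<open>\<open>h(z) = z u(z)\<close> with \<open>u(0) = h'(0)\<close> nonzero:
  \<open>u(z)\<close> is the unit by which \<open>z\<close> and \<open>w^2\<close> differ.\<close>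

definition u :: "'a poly" where "u = poly_shift 1 h"

lemma x_transcendental: "eval1 \<iota> p x = 0 \<Longrightarrow> p = 0"
  using curve by (auto simp: hyperelliptic_curve_def)

lemma x_neq_0: "x \<noteq> 0"
  using x_transcendental[of "[:0, 1:]"] by auto

lemma degree_f: "degree f = 2 * g + 1"
  using curve by (simp add: hyperelliptic_curve_def)

text \<open>The reciprocal polynomial carries a relation for \<open>1/x\<close> to one for
  \<open>x\<close>.\<close>

lemma z_transcendental:
  assumes "eval1 \<iota> p z = 0"
  shows "p = 0"
proof -
  let ?n = "degree p"
  have "eval1 \<iota> (reflect_poly p) x = (\<Sum>i\<le>?n. \<iota> (coeff (reflect_poly p) i) * x ^ i)"
    by (rule eval1_sum_coeff[OF degree_reflect_poly_le])
  also have "\<dots> = (\<Sum>i\<le>?n. \<iota> (coeff p (?n - i)) * x ^ i)"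
    by (intro sum.cong) (auto simp: coeff_reflect_poly)
  also have "\<dots> = (\<Sum>i\<le>?n. \<iota> (coeff p i) * x ^ (?n - i))"
    by (subst sum.nat_diff_reindex[symmetric, of _ "Suc ?n", unfolded lessThan_Suc_atMost]) (auto intro!: sum.cong)
  also have "\<dots> = x ^ ?n * (\<Sum>i\<le>?n. \<iota> (coeff p i) * z ^ i)"
    unfolding sum_distrib_left
    using x_neq_0 by (intro sum.cong) (auto simp: z_coord_def power_diff field_simps)
  also have "\<dots> = 0"
    using assms by (simp add: eval1_sum_coeff[OF order_refl])
  finally have "reflect_poly p = 0" by (rule x_transcendental)
  thus ?thesis by simp
qed

lemma coeff_h: "coeff h k = (if k \<le> 2 * g + 2 then coeff f (2 * g + 2 - k) else 0)"
proof -
  have "coeff h k = (\<Sum>i\<le>2 * g + 2. if i = 2 * g + 2 - k \<and> k \<le> 2 * g + 2 then coeff f i else 0)"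
    unfolding h_poly_def coeff_sum by (intro sum.cong) auto
  also have "\<dots> = (if k \<le> 2 * g + 2 then coeff f (2 * g + 2 - k) else 0)"
    by (cases "k \<le> 2 * g + 2") (simp_all add: sum.delta del: sum.atMost_Suc)
  finally show ?thesis .
qed

lemma coeff_h_1: "coeff h 1 \<noteq> 0"
proof -
  have "coeff h 1 = lead_coeff f" by (simp add: coeff_h degree_f)
  moreover have "f \<noteq> 0" using degree_f by auto
  ultimately show ?thesis by simp
qed

lemma h_eq: "h = pCons 0 u"
proof (rule poly_eqI)
  fix k
  have "coeff f (2 * g + 2) = 0" by (rule coeff_eq_0) (simp add: degree_f)
  thus "coeff h k = coeff (pCons 0 u) k"
    by (cases k) (simp_all add: u_def coeff_poly_shift coeff_h)
qed

lemma coeff_u_0: "coeff u 0 = coeff h 1"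
  by (simp add: u_def coeff_poly_shift)

lemma u_neq_0: "u \<noteq> 0"
  using coeff_u_0 coeff_h_1 by auto

lemma poly_pderiv_h: "poly (pderiv h) 0 = coeff h 1"
  by (simp add: poly_0_coeff_0 coeff_pderiv)

lemma w_square: "w ^ 2 = eval1 \<iota> h z"
proof -
  have "eval1 \<iota> h z = (\<Sum>i\<le>2 * g + 2. \<iota> (coeff f i) * z ^ (2 * g + 2 - i))"
    by (simp only: h_poly_def eval1_sum eval1_monom)
  also have "\<dots> = (\<Sum>i\<le>2 * g + 2. \<iota> (coeff f i) * x ^ i) / x ^ (2 * g + 2)"
    unfolding sum_divide_distrib
    using x_neq_0 by (intro sum.cong) (auto simp: z_coord_def power_diff field_simps)
  also have "(\<Sum>i\<le>2 * g + 2. \<iota> (coeff f i) * x ^ i) = eval1 \<iota> f x"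
    by (rule eval1_sum_coeff[symmetric]) (simp add: degree_f)
  also have "\<dots> = y ^ 2" using curve by (simp add: hyperelliptic_curve_def)
  also have "x ^ (2 * g + 2) = (x ^ (g + 1)) ^ 2"
    unfolding power_mult[symmetric] by (simp add: algebra_simps)
  finally show ?thesis by (simp add: w_coord_def power_divide)
qed

lemma z_mult_u: "z * eval1 \<iota> u z = w ^ 2"
  unfolding w_square h_eq by simp

text \<open>\<open>h\<close> has odd order at \<open>0\<close>, so it is not a square in \<open>F(z)\<close>.\<close>

lemma independent:
  assumes "eval1 \<iota> A z + w * eval1 \<iota> B z = 0"
  shows "A = 0 \<and> B = 0"
proof -
  have "eval1 \<iota> A z = - w * eval1 \<iota> B z" using assms by (simp add: eq_neg_iff_add_eq_0)
  hence "eval1 \<iota> (A * A - h * (B * B)) z = 0"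
    by (simp add: eval1_diff eval1_mult w_square[symmetric] power2_eq_square)
  hence eq: "A * A = h * (B * B)" using z_transcendental by force
  have "B = 0"
  proof (rule ccontr)
    assume B: "B \<noteq> 0"
    have h: "h = [:- 0, 1:] ^ 1 * u" by (simp add: h_eq)
    have nz: "h \<noteq> 0" "A \<noteq> 0" using u_neq_0 B eq by (auto simp: h_eq)
    have "order 0 u = 0" using coeff_u_0 coeff_h_1 by (intro order_0I) (simp add: poly_0_coeff_0)
    hence "order 0 ([:- 0, 1:] ^ 1 * u) = 1"
      using order_mult[OF nz(1)[unfolded h], of 0] order_power_n_n[of "0 :: 'a" 1] by linarith
    hence "order 0 h = 1" by (simp only: h)
    moreover have "order 0 A + order 0 A = order 0 h + (order 0 B + order 0 B)"
      using arg_cong[OF eq, of "order 0"] nz B by (simp add: order_mult)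
    ultimately show False by presburger
  qed
  with eq show ?thesis by simp
qed

text \<open>Even powers of \<open>w\<close> become powers of \<open>h(z)\<close>. Since
  \<open>h(0) = 0\<close>, this leaves the value at the origin unchanged.\<close>

lemma eval2_normal_form:
  "\<exists>A B. eval2 \<iota> P z w = eval1 \<iota> A z + w * eval1 \<iota> B z \<and> poly A 0 = poly (poly P 0) 0"
proof (induction P)
  case 0
  show ?case by (intro exI[of _ 0]) simp
next
  case (pCons p P)
  then obtain A B where AB: "eval2 \<iota> P z w = eval1 \<iota> A z + w * eval1 \<iota> B z" by blast
  have "eval2 \<iota> (pCons p P) z w = eval1 \<iota> (p + h * B) z + w * eval1 \<iota> A z"
    by (simp add: AB eval1_add eval1_mult w_square[symmetric] power2_eq_square algebra_simps)
  moreover have "poly (p + h * B) 0 = poly (poly (pCons p P) 0) 0" by (simp add: h_eq)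
  ultimately show ?case by blast
qed

lemma eval2_neq_0:
  assumes "poly (poly Q 0) 0 \<noteq> 0"
  shows "eval2 \<iota> Q z w \<noteq> 0"
proof
  assume "eval2 \<iota> Q z w = 0"
  moreover obtain A B where "eval2 \<iota> Q z w = eval1 \<iota> A z + w * eval1 \<iota> B z" "poly A 0 = poly (poly Q 0) 0"
    using eval2_normal_form by blast
  ultimately show False using independent[of A B] assms by auto
qed

lemma RI: "poly (poly Q 0) 0 \<noteq> 0 \<Longrightarrow> a = eval2 \<iota> P z w / eval2 \<iota> Q z w \<Longrightarrow> a \<in> R"
  unfolding local_ring_inf_def by blast

lemma RE:
  assumes "a \<in> R"
  obtains P Q where "poly (poly Q 0) 0 \<noteq> 0" "eval2 \<iota> Q z w \<noteq> 0" "a = eval2 \<iota> P z w / eval2 \<iota> Q z w"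
  using assms eval2_neq_0 unfolding local_ring_inf_def by blast

lemma eval2_mem: "eval2 \<iota> P z w \<in> R"
  by (rule RI[of 1 _ P]) simp_all

lemma inverse_eval2_mem: "poly (poly P 0) 0 \<noteq> 0 \<Longrightarrow> inverse (eval2 \<iota> P z w) \<in> R"
  by (rule RI[of P _ 1]) (simp_all add: field_simps)

lemma R_mult: "a \<in> R \<Longrightarrow> b \<in> R \<Longrightarrow> a * b \<in> R"
proof (elim RE)
  fix P Q P' Q'
  assume "poly (poly Q 0) 0 \<noteq> 0" "poly (poly Q' 0) 0 \<noteq> 0"
    "a = eval2 \<iota> P z w / eval2 \<iota> Q z w" "b = eval2 \<iota> P' z w / eval2 \<iota> Q' z w"
  thus "a * b \<in> R" by (intro RI[of "Q * Q'" _ "P * P'"]) (simp_all add: eval2_mult)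
qed

lemma R_add: "a \<in> R \<Longrightarrow> b \<in> R \<Longrightarrow> a + b \<in> R"
proof (elim RE)
  fix P Q P' Q'
  assume "poly (poly Q 0) 0 \<noteq> 0" "poly (poly Q' 0) 0 \<noteq> 0"
    "eval2 \<iota> Q z w \<noteq> 0" "eval2 \<iota> Q' z w \<noteq> 0"
    "a = eval2 \<iota> P z w / eval2 \<iota> Q z w" "b = eval2 \<iota> P' z w / eval2 \<iota> Q' z w"
  thus "a + b \<in> R"
    by (intro RI[of "Q * Q'" _ "P * Q' + P' * Q"]) (simp_all add: eval2_mult eval2_add add_frac_eq)
qed

lemma w_mem: "w \<in> R"
  using eval2_mem[of "[:0, 1:]"] by simp

lemma eval1_z_mem: "eval1 \<iota> p z \<in> R"
  using eval2_mem[of "[:p:]"] by simp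

lemma const_in_R: "\<iota> c \<in> R"
  using eval1_z_mem[of "[:c:]"] by simp

lemma inverse_eval1_z_mem: "coeff p 0 \<noteq> 0 \<Longrightarrow> inverse (eval1 \<iota> p z) \<in> R"
  using inverse_eval2_mem[of "[:p:]"] by (simp add: poly_0_coeff_0)

lemma eval1_u_neq_0: "eval1 \<iota> u z \<noteq> 0"
  using z_transcendental u_neq_0 by blast

lemma z_eq: "z = w * (w * inverse (eval1 \<iota> u z))"
  using z_mult_u eval1_u_neq_0 by (simp add: field_simps power2_eq_square)

lemma w_neq_0: "w \<noteq> 0"
  using z_eq x_neq_0 by (auto simp: z_coord_def)

text \<open>Without a constant term every monomial contains \<open>z\<close> or \<open>w\<close>,
  and \<open>z\<close> is itself a multiple of \<open>w\<close>. This is why \<open>w\<close>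
  generates the maximal ideal.\<close>

lemma eval2_divisible:
  assumes "poly (poly P 0) 0 = 0"
  shows "\<exists>b\<in>R. eval2 \<iota> P z w = w * b"
proof -
  obtain p P' where P: "P = pCons p P'" by (cases P)
  obtain c q where p: "p = pCons c q" by (cases p)
  have c: "c = 0" using assms by (simp add: P p)
  let ?b = "w * inverse (eval1 \<iota> u z) * eval1 \<iota> q z + eval2 \<iota> P' z w"
  have "eval2 \<iota> P z w = z * eval1 \<iota> q z + w * eval2 \<iota> P' z w" by (simp add: P p c)
  also have "\<dots> = w * ?b" by (subst z_eq) (simp only: distrib_left mult.assoc)
  finally have "eval2 \<iota> P z w = w * ?b" .
  moreover have "?b \<in> R"
    by (intro R_add R_mult w_mem eval2_mem eval1_z_mem inverse_eval1_z_mem) (simp add: coeff_u_0 coeff_h_1[simplified])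
  ultimately show ?thesis by blast
qed

text \<open>If \<open>w P / Q = 1\<close>, then \<open>Q - w P\<close> vanishes as a function
  although its value at the origin is that of \<open>Q\<close>.\<close>

lemma w_no_unit:
  assumes "b \<in> R"
  shows "w * b \<noteq> 1"
proof
  assume eq: "w * b = 1"
  from assms obtain P Q where Q: "poly (poly Q 0) 0 \<noteq> 0" "eval2 \<iota> Q z w \<noteq> 0"
    and b: "b = eval2 \<iota> P z w / eval2 \<iota> Q z w" by (rule RE)
  have "eval2 \<iota> (Q + smult (- 1) (pCons 0 P)) z w = 0"
    using eq Q(2) unfolding eval2_add eval2_smult
    by (simp add: b field_simps eval1_minus)
  moreover have "poly (poly (Q + smult (- 1) (pCons 0 P)) 0) 0 \<noteq> 0" using Q(1) by simp
  ultimately show False using eval2_neq_0 by blast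
qed

lemma R_power: "a \<in> R \<Longrightarrow> a ^ n \<in> R"
  by (induction n) (use eval1_z_mem[of 1] in \<open>auto intro: R_mult\<close>)

text \<open>Multiplying by the conjugate \<open>A - w B\<close> of a numerator \<open>A + w B\<close> gives a nonzero polynomial in
  \<open>z\<close>, whose order at \<open>0\<close> bounds the powers of \<open>w\<close> dividing the element.\<close>

lemma R_separated:
  assumes "a \<in> R" and div: "\<And>n. \<exists>b\<in>R. a = w ^ n * b"
  shows "a = 0"
proof (rule ccontr)
  assume "a \<noteq> 0"
  from assms(1) obtain P Q where Q: "eval2 \<iota> Q z w \<noteq> 0" and a: "a = eval2 \<iota> P z w / eval2 \<iota> Q z w"
    by (rule RE)
  obtain A B where AB: "eval2 \<iota> P z w = eval1 \<iota> A z + w * eval1 \<iota> B z" using eval2_normal_form by blast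
  define e where "e = eval1 \<iota> A z + w * eval1 \<iota> B z"
  define e' where "e' = eval1 \<iota> A z + w * eval1 \<iota> (- B) z"
  define N where "N = A * A - h * (B * B)"
  have e: "e \<noteq> 0" "e = a * eval2 \<iota> Q z w" using \<open>a \<noteq> 0\<close> a AB Q by (auto simp: e_def)
  have e': "e' \<noteq> 0" using independent[of A "- B"] e(1) by (auto simp: e'_def e_def)
  have e'R: "e' \<in> R" unfolding e'_def by (intro R_add R_mult w_mem eval1_z_mem)
  have Nz: "eval1 \<iota> N z = e * e'"
    by (simp add: N_def e_def e'_def eval1_diff eval1_mult eval1_minus w_square[symmetric]
        power2_eq_square algebra_simps)
  with e e' have "N \<noteq> 0" by auto
  from order_decomp[OF this, of 0] obtain q where q: "N = [:- 0, 1:] ^ order 0 N * q" "\<not> [:- 0, 1:] dvd q"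
    by blast
  define k where "k = order 0 N"
  have q0: "coeff q 0 \<noteq> 0" using q(2) unfolding poly_eq_0_iff_dvd[symmetric] poly_0_coeff_0 .
  have "[:- 0, 1 :: 'a:] ^ k = monom 1 k" by (simp add: monom_altdef)
  with q(1) have "N = monom 1 k * q" by (simp add: k_def)
  hence "e * e' = z ^ k * eval1 \<iota> q z" by (simp add: Nz[symmetric] eval1_mult eval1_monom)
  hence "eval1 \<iota> u z ^ k * (e * e') = (z * eval1 \<iota> u z) ^ k * eval1 \<iota> q z"
    by (simp add: power_mult_distrib)
  hence eq: "eval1 \<iota> u z ^ k * (e * e') = w ^ (2 * k) * eval1 \<iota> q z"
    by (simp only: z_mult_u power_mult)
  \<comment> \<open>The exponent exceeds by one the power \<open>w^(2k)\<close> contained in the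
    norm up to units; this excess would make \<open>w\<close> a unit.\<close>
  obtain b where b: "b \<in> R" "a = w ^ Suc (2 * k) * b" using div by blast
  let ?c = "eval1 \<iota> u z ^ k * (b * eval2 \<iota> Q z w * e') * inverse (eval1 \<iota> q z)"
  have "w ^ (2 * k) * (w * (eval1 \<iota> u z ^ k * (b * eval2 \<iota> Q z w * e'))) = w ^ (2 * k) * eval1 \<iota> q z"
    unfolding eq[symmetric] e(2) b(2) by simp
  hence "w * (eval1 \<iota> u z ^ k * (b * eval2 \<iota> Q z w * e')) = eval1 \<iota> q z" using w_neq_0 by simp
  moreover have "eval1 \<iota> q z \<noteq> 0" using q0 z_transcendental by force
  ultimately have "w * ?c = 1" by (metis mult.assoc right_inverse)
  moreover have "?c \<in> R"
    by (intro R_mult R_power eval1_z_mem eval2_mem e'R b inverse_eval1_z_mem q0)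
  ultimately show False using w_no_unit by blast
qed

sublocale local: uniformized_ring \<iota> R w
proof
  fix a b c
  show "\<iota> c \<in> R" by (rule const_in_R)
  show "a \<in> R \<Longrightarrow> b \<in> R \<Longrightarrow> a + b \<in> R" by (rule R_add)
  show "a \<in> R \<Longrightarrow> b \<in> R \<Longrightarrow> a * b \<in> R" by (rule R_mult)
  show "w \<in> R" "w \<noteq> 0" by (rule w_mem w_neq_0)+
  show "\<exists>c. \<exists>b\<in>R. a = \<iota> c + w * b" if "a \<in> R"
  proof -
    from that obtain P Q where Q: "poly (poly Q 0) 0 \<noteq> 0" "eval2 \<iota> Q z w \<noteq> 0"
      and a: "a = eval2 \<iota> P z w / eval2 \<iota> Q z w" by (rule RE)
    \<comment> \<open>The value of \<open>a\<close> at the point at infinity; subtracting it makes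
      the numerator vanish at the origin.\<close>
    define c where "c = poly (poly P 0) 0 / poly (poly Q 0) 0"
    have "poly (poly (P + smult [:- c:] Q) 0) 0 = 0" using Q(1) by (simp add: c_def)
    then obtain b where b: "b \<in> R" "eval2 \<iota> (P + smult [:- c:] Q) z w = w * b"
      using eval2_divisible by blast
    have "a = \<iota> c + w * (b * inverse (eval2 \<iota> Q z w))"
      using b(2) Q(2) by (simp add: a eval2_add eval2_smult hom_uminus field_simps)
    thus ?thesis using R_mult[OF b(1) inverse_eval2_mem[OF Q(1)]] by blast
  qed
  show "b \<in> R \<Longrightarrow> w * b \<noteq> 1" by (rule w_no_unit)
  show "inverse (\<iota> c + w * b) \<in> R" if c: "c \<noteq> 0" and "b \<in> R"
  proof -
    from \<open>b \<in> R\<close> obtain P Q where Q: "poly (poly Q 0) 0 \<noteq> 0" "eval2 \<iota> Q z w \<noteq> 0"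
      and b: "b = eval2 \<iota> P z w / eval2 \<iota> Q z w" by (rule RE)
    have "poly (poly (smult [:c:] Q + pCons 0 P) 0) 0 \<noteq> 0" using c Q(1) by simp
    moreover have "inverse (\<iota> c + w * b) = eval2 \<iota> Q z w / eval2 \<iota> (smult [:c:] Q + pCons 0 P) z w"
      using Q(2) by (simp add: b eval2_add eval2_smult divide_simps)
    ultimately show ?thesis by (rule RI)
  qed
  show "a = 0" if "a \<in> R" "\<And>n. \<exists>b\<in>R. a = w ^ n * b" by (rule R_separated[OF that])
qed

lemma max_ideal: "max_ideal_inf \<iota> x y g = principal R w"
proof (intro equalityI subsetI)
  fix a assume "a \<in> max_ideal_inf \<iota> x y g"
  then obtain P Q where P: "poly (poly P 0) 0 = 0" and Q: "poly (poly Q 0) 0 \<noteq> 0"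
    and a: "a = eval2 \<iota> P z w / eval2 \<iota> Q z w" unfolding max_ideal_inf_def by blast
  from eval2_divisible[OF P] obtain b where "b \<in> R" "eval2 \<iota> P z w = w * b" by blast
  thus "a \<in> principal R w"
    unfolding principal_def a using R_mult[OF _ inverse_eval2_mem[OF Q]] by (auto simp: divide_inverse)
next
  fix a assume "a \<in> principal R w"
  then obtain b where "b \<in> R" and a: "a = w * b" unfolding principal_def by blast
  then obtain P Q where Q: "poly (poly Q 0) 0 \<noteq> 0" and b: "b = eval2 \<iota> P z w / eval2 \<iota> Q z w"
    by (elim RE)
  have "a = eval2 \<iota> (pCons 0 P) z w / eval2 \<iota> Q z w" "poly (poly (pCons 0 P) 0) 0 = 0"
    by (simp_all add: a b)
  with Q show "a \<in> max_ideal_inf \<iota> x y g" unfolding max_ideal_inf_def by blast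
qed

lemma z_mem: "z \<in> R"
  using eval1_z_mem[of "[:0, 1:]"] by simp

text \<open>This comes from \<open>z u(z) = w^2\<close>. That \<open>z\<close> has no constant term
  is settled beforehand, since it identifies the constant term of \<open>u(z)\<close> as
  \<open>u(0) = h'(0)\<close>.\<close>

lemma taylor_z: "\<exists>V. local.taylor z = fps_X ^ 2 * V \<and> fps_nth V 0 = inverse (coeff h 1)"
proof -
  have eq: "local.taylor z * local.taylor (eval1 \<iota> u z) = fps_X ^ 2"
    using arg_cong[OF z_mult_u, of local.taylor]
    by (simp add: local.taylor_mult z_mem eval1_z_mem local.taylor_power w_mem local.taylor_uniformizer)
  have "\<forall>i<1. fps_nth (local.taylor z) i = 0"
    unfolding local.taylor_low_eq_0_iff[OF z_mem]
    by (intro bexI[of _ "w * inverse (eval1 \<iota> u z)"], subst z_eq)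
      (simp_all add: R_mult w_mem inverse_eval1_z_mem coeff_u_0 coeff_h_1[simplified])
  hence "fps_nth (local.taylor (eval1 \<iota> u z)) 0 = coeff h 1"
    by (simp add: local.taylor_eval1_nth_0 z_mem poly_0_coeff_0 coeff_u_0)
  moreover from this have "local.taylor z = fps_X ^ 2 * inverse (local.taylor (eval1 \<iota> u z))"
    using coeff_h_1 inverse_mult_eq_1'[of "local.taylor (eval1 \<iota> u z)"] eq[symmetric]
    by (simp add: mult.assoc)
  ultimately show ?thesis by (metis fps_inverse_nth_0)
qed

text \<open>\<open>h(z) = w^2\<close> is smooth and \<open>h'\<close> does not vanish at the point:
  here \<open>w\<close> enters as an etale coordinate.\<close>

lemma smooth_z: "local.smooth z"
proof (rule local.smooth_root[OF z_mem, of h])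
  show "local.smooth (eval1 \<iota> h z)"
    unfolding w_square[symmetric] power2_eq_square
    by (intro local.smooth_mult local.smooth_uniformizer)
  obtain V where "local.taylor z = fps_X ^ 2 * V" using taylor_z by blast
  hence "fps_nth (local.taylor z) 0 = 0" by simp
  thus "fps_nth (local.taylor (eval1 \<iota> (pderiv h) z)) 0 \<noteq> 0"
    using coeff_h_1 by (simp add: local.taylor_eval1_nth_0 z_mem poly_pderiv_h)
qed

text \<open>Elements of \<open>R\<close> are quotients of polynomials in the smooth elements
  \<open>z\<close> and \<open>w\<close>. The denominators are invertible in \<open>R\<close>, which
  forces a nonzero constant term and makes \<open>smooth_inverse\<close> applicable.\<close>

sublocale local: hasse_ring \<iota> R w
proof
  fix a k assume "a \<in> R"
  then obtain P Q where Q: "poly (poly Q 0) 0 \<noteq> 0" "eval2 \<iota> Q z w \<noteq> 0"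
    and a: "a = eval2 \<iota> P z w / eval2 \<iota> Q z w" by (rule RE)
  have smooth: "local.smooth (eval2 \<iota> P z w)" for P
    by (intro local.smooth_eval2 smooth_z local.smooth_uniformizer)
  have one: "local.taylor (eval2 \<iota> Q z w) * local.taylor (inverse (eval2 \<iota> Q z w)) = 1"
    using local.taylor_mult[OF eval2_mem[of Q] inverse_eval2_mem[OF Q(1)]] Q(2) by simp
  have "fps_nth (local.taylor (eval2 \<iota> Q z w)) 0 \<noteq> 0"
    using arg_cong[OF one, of "\<lambda>s. fps_nth s 0"] by auto
  hence "local.smooth a"
    unfolding a divide_inverse by (intro local.smooth_mult local.smooth_inverse smooth)
  thus "\<exists>b\<in>R. local.taylor b = fps_hasse k (local.taylor a)"
    unfolding local.smooth_def local.taylor_image_def by (metis imageE)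
qed

text \<open>Division of \<open>x^j\<close> by the generator \<open>x^l\<close> gives
  \<open>z^(l - j)\<close>, hence the decreasing exponents along the columns.\<close>

lemma taylor_wronskian:
  defines "\<phi> l \<equiv> hasse_wronskian \<iota> R w (x ^ l) (map (\<lambda>j. x ^ j) [0..<l + 1])"
  shows "\<phi> l \<in> R"
    and "\<exists>E. local.taylor (\<phi> l) = fps_X ^ (Suc l choose 2) * E \<and>
      fps_nth E 0 = (- 2 / coeff h 1) ^ (Suc l choose 2)"
proof -
  have \<phi>: "\<phi> l = det (mat (Suc l) (Suc l) (\<lambda>(i, j). hasse_deriv \<iota> R w i (z ^ (l - j))))"
  proof -
    have "map (\<lambda>j. x ^ j) [0..<l + 1] ! j / x ^ l = z ^ (l - j)" if "j < Suc l" for j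
      using that x_neq_0 by (simp add: z_coord_def power_diff field_simps del: upt_Suc)
    thus ?thesis
      unfolding \<phi>_def hasse_wronskian_def
      by (intro arg_cong[of _ _ det] eq_matI) auto
  qed
  have zR: "z ^ n \<in> R" for n by (rule R_power[OF z_mem])
  show "\<phi> l \<in> R" unfolding \<phi> by (intro local.det_mem local.hasse_deriv_mem zR)
  obtain V where V: "local.taylor z = fps_X ^ 2 * V" "fps_nth V 0 = inverse (coeff h 1)"
    using taylor_z by blast
  have "local.taylor (\<phi> l) =
      det (mat (Suc l) (Suc l) (\<lambda>(i, j). fps_hasse i ((fps_X ^ 2 * V) ^ (l - j))))"
    unfolding \<phi> by (subst local.det_mem(2))
      (simp_all add: local.hasse_deriv_mem zR local.taylor_hasse_deriv local.taylor_power z_mem V(1))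
  with fps_wronskian_leading_term[of l V]
  show "\<exists>E. local.taylor (\<phi> l) = fps_X ^ (Suc l choose 2) * E \<and>
      fps_nth E 0 = (- 2 / coeff h 1) ^ (Suc l choose 2)"
    by (simp add: V(2) divide_inverse)
qed

end

theorem theorem3p9:
  fixes f :: "'a::field poly" and \<iota> :: "'a \<Rightarrow> 'k::field" and x y :: 'k and g l :: nat
  assumes "(2::'a) \<noteq> 0"
    and "hyperelliptic_curve \<iota> x y f g"
    and "1 \<le> l" and "l \<le> g" and "l mod 4 = 1"
  shows "wronskian_index_inf \<iota> x y g (x ^ l) (map (\<lambda>j. x ^ j) [0..<l + 1]) =
    (\<Sum>_<(((l + 1) choose 2) - 1) div 2. gw_hyperbolic)
      + gw_unit (- (poly (pderiv (h_poly g f)) 0 / 2))"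
proof -
  interpret hyperelliptic_infinity \<iota> x y f g by unfold_locales (fact assms(2))
  let ?N = "Suc l choose 2"
  let ?a = "coeff h 1"
  define K where "K = (?N - 1) div 2"
  obtain m where l: "l = 4 * m + 1" using assms(5) by (metis add.commute div_mod_decomp mult.commute)
  \<comment> \<open>Both factors are odd; this is where the residue class of \<open>l\<close> modulo
    4 enters.\<close>
  have "?N = (2 * m + 1) * (4 * m + 1)"
    unfolding choose_two l by (simp add: algebra_simps)
  hence "odd ?N" by simp
  hence N: "?N = 2 * K + 1" unfolding K_def by presburger
  obtain E where E: "local.taylor (hasse_wronskian \<iota> R w (x ^ l) (map (\<lambda>j. x ^ j) [0..<l + 1])) = fps_X ^ ?N * E"
    "fps_nth E 0 = (- 2 / ?a) ^ ?N" using taylor_wronskian(2) by blast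
  have a: "?a \<noteq> 0" by (rule coeff_h_1)
  \<comment> \<open>The choice \<open>b = (2/a)^K\<close> is made so that \<open>b^2\<close> turns
    \<open>(-a/2)^(2K + 1)\<close> into exactly \<open>-a/2\<close>.\<close>
  have "fps_nth E 0 \<noteq> 0" "(2 / ?a) ^ K \<noteq> 0" using a assms(1) by (simp_all add: E(2))
  note index = local.euler_index_odd_order[OF assms(1) taylor_wronskian(1) E(1) this(1) N this(2)]
  have "inverse (fps_nth E 0) * ((2 / ?a) ^ K) ^ 2 = - (?a / 2)"
  proof -
    let ?s = "((2 / ?a) ^ K) ^ 2"
    have "?s \<noteq> 0" using a assms(1) by simp
    have "inverse (fps_nth E 0) = inverse ?s * - (?a / 2)"
      unfolding E(2) N by (simp add: power_mult[symmetric] mult.commute power_minus[of "2 / ?a"] inverse_eq_divide)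
    hence "inverse (fps_nth E 0) * ?s = (inverse ?s * ?s) * - (?a / 2)" by (simp only: mult_ac)
    also have "inverse ?s * ?s = 1" by (rule left_inverse) fact
    finally show ?thesis by simp
  qed
  thus ?thesis
    unfolding wronskian_index_inf_def Let_def max_ideal index poly_pderiv_h by (simp add: K_def)
qed

end
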